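(* Let $p$ be a prime number, $G=\mathbb{Z}_p\times\mathbb{Z}_p$, and $1\le k\le p^2$. There are equality cases for $(k,G)$ if and only if $\theta(k,G)<\theta(k-1,G)$ (with the convention $\theta(0,G)=+\infty$). They can be described as follows. (i) For all $k\le p$, every equality case for $(k,G)$ is a translate of an equality case for $(k,G)$ whose support is contained in some subgroup $G_m$ ($m\neq 0$). In particular, when $m=(m_1,m_2)$ satisfies $m_1^2+m_2^2\not\equiv0 \pmod p$, the translates of equality cases supported in $G_m$ are transforms under $A(m)$ of functions of the form $f\otimes\delta_{\mathbb{Z}_p}(\cdot-a)$, with $a\in\mathbb{Z}_p$ and $f\in L(\mathbb{Z}_p)$ such that $|\operatorname{supp} f|=k$ and $|\operatorname{supp}\widehat f|=p-k+1$. (ii) For all $p\le k\le p^2-1$, there are equality cases for $(k,G)$ if and only if $k$ is divisible by $p$. For $k=pj$, the Fourier transforms of equality cases for $(k,G)$ are equality cases for $(p-j+1,\widehat G)$, where $\widehat G$ is identified with $G$.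
   Context: Notation: $\mathbb{Z}_n=\mathbb{Z}/n\mathbb{Z}$. For a finite Abelian group $G$, $L(G)$ is the space of complex functions on $G$, $\widehat G$ is the group of characters of $G$, and $\widehat f(\chi)=\sum_{x\in G}f(x)\chi(-x)$ for $f\in L(G)$, $\chi\in\widehat G$. For $1\le k\le|G|$, Meshulam's function is $$\theta(k,G)=\min\{\,|\operatorname{supp}\widehat f| : f\in L(G),\ f\ne0,\ |\operatorname{supp} f|\le k\}.$$ An equality case for $(k,G)$ is a function $f\in L(G)$ with $|\operatorname{supp} f|=k$ and $|\operatorname{supp}\widehat f|=\theta(k,G)$. For $G=\mathbb{Z}_p\times\mathbb{Z}_p$, $\widehat G$ is identified with $G$ by letting $y=(y_1,y_2)$ correspond to the character $x\mapsto\exp(2\pi i(x_1y_1+x_2y_2)/p)$. For a nonzero $m=(m_1,m_2)\in G$, $G_m=\{jm: j\in\mathbb{Z}_p\}$ is the subgroup generated by $m$. $A(m)$ is the matrix $\begin{pmatrix} m_1&-m_2\\ m_2&m_1\end{pmatrix}$ over the field $\mathbb{Z}_p$, which is invertible when $m_1^2+m_2^2\not\equiv0$; the transform of a function $f$ on $G$ under $A(m)$ is then $x\mapsto f(A(m)^{-1}x)$. $\delta_{\mathbb{Z}_p}=\mathds{1}_{\{0\}}$ and $(g\otimes h)(x_1,x_2)=g(x_1)h(x_2)$. A translate of $f$ is a function $f(\cdot-c)$, $c\in G$. *)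

theory Defs
  imports "HOL-Analysis.Analysis" "HOL-Library.Extended_Nat"
    "Berlekamp_Zassenhaus.Finite_Field"
begin

section \<open>Fourier transform and Meshulam's function on a finite Abelian group\<close>

text \<open>
  A finite Abelian group \<open>G\<close> is a type of sort \<open>{finite, ab_group_add}\<close>, and \<open>L(G)\<close> is the
  type of all functions from it to the complex numbers.
\<close>

abbreviation supp :: "('g \<Rightarrow> complex) \<Rightarrow> 'g set"
  where "supp f \<equiv> support_on UNIV f"

definition characters :: "('g::ab_group_add \<Rightarrow> complex) set"
  where "characters = {\<psi>. (\<forall>x. cmod (\<psi> x) = 1) \<and> (\<forall>x y. \<psi> (x + y) = \<psi> x * \<psi> y)}"

definition fourier :: "('g::{finite,ab_group_add} \<Rightarrow> complex) \<Rightarrow> ('g \<Rightarrow> complex) \<Rightarrow> complex"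
  where "fourier f \<psi> = (\<Sum>x\<in>UNIV. f x * \<psi> (- x))"

text \<open>
  \<open>fourier f\<close> is a function on the character group only, so its support is taken there.
\<close>

abbreviation fourier_supp :: "('g::{finite,ab_group_add} \<Rightarrow> complex) \<Rightarrow> ('g \<Rightarrow> complex) set"
  where "fourier_supp f \<equiv> support_on characters (fourier f)"

text \<open>
  For \<open>k \<ge> 1\<close> the infimum is over a nonempty set of (finite) extended naturals, hence a minimum.
  For \<open>k = 0\<close> the set is empty and the value is \<open>\<infinity>\<close>, which is the usual convention.
\<close>

definition theta :: "nat \<Rightarrow> 'g::{finite,ab_group_add} itself \<Rightarrow> enat"
  where "theta k G =
    Inf {enat (card (fourier_supp f)) | f :: 'g \<Rightarrow> complex. f \<noteq> (\<lambda>_. 0) \<and> card (supp f) \<le> k}"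

definition equality_case :: "nat \<Rightarrow> ('g::{finite,ab_group_add} \<Rightarrow> complex) \<Rightarrow> bool"
  where "equality_case k f \<longleftrightarrow>
    card (supp f) = k \<and> enat (card (fourier_supp f)) = theta k TYPE('g)"

definition translate :: "'g::ab_group_add \<Rightarrow> ('g \<Rightarrow> complex) \<Rightarrow> 'g \<Rightarrow> complex"
  where "translate c f = (\<lambda>x. f (x - c))"

definition delta :: "'g::zero \<Rightarrow> complex"
  where "delta = indicator {0}"

section \<open>The group \<open>\<int>\<^sub>p \<times> \<int>\<^sub>p\<close>\<close>

text \<open>
  \<open>'p mod_ring\<close> with \<open>'p\<close> of class \<open>prime_card\<close> is the field \<open>\<int>\<^sub>p\<close> for the prime \<open>p = CARD('p)\<close>;
  pairs are vectors indexed by the two-element type, so that matrices over \<open>\<int>\<^sub>p\<close> act on them.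
\<close>

type_synonym 'p plane = "'p mod_ring ^ 2"

definition plane_char :: "'p::prime_card plane \<Rightarrow> 'p plane \<Rightarrow> complex"
  where "plane_char y x =
    exp (2 * of_real pi * \<i> * of_int (to_int_mod_ring (x $ 1 * y $ 1 + x $ 2 * y $ 2))
      / of_nat CARD('p))"

text \<open>
  The Fourier transform as a function on the group itself, the character group being identified
  with it through \<open>plane_char\<close>.
\<close>

definition plane_fourier :: "('p::prime_card plane \<Rightarrow> complex) \<Rightarrow> 'p plane \<Rightarrow> complex"
  where "plane_fourier f = (\<lambda>y. fourier f (plane_char y))"

definition line :: "'p::prime_card plane \<Rightarrow> 'p plane set"
  where "line m = range (\<lambda>j. j *s m)"

definition A :: "'p::prime_card plane \<Rightarrow> 'p mod_ring ^ 2 ^ 2"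
  where "A m = vector [vector [m $ 1, - (m $ 2)], vector [m $ 2, m $ 1]]"

definition transform ::
    "'p::prime_card mod_ring ^ 2 ^ 2 \<Rightarrow> ('p plane \<Rightarrow> complex) \<Rightarrow> 'p plane \<Rightarrow> complex"
  where "transform M f = (\<lambda>x. f (matrix_inv M *v x))"

definition tensor ::
    "('p::prime_card mod_ring \<Rightarrow> complex) \<Rightarrow> ('p mod_ring \<Rightarrow> complex) \<Rightarrow> 'p plane \<Rightarrow> complex"
    (infixr \<open>\<otimes>\<^sub>f\<close> 70)
  where "g \<otimes>\<^sub>f h = (\<lambda>x. g (x $ 1) * h (x $ 2))"

end

theory Submission
  imports Defs "Berlekamp_Zassenhaus.Factor_Bound"
begin

text \<open>
  On \<open>\<int>\<^sub>p\<close> one has \<open>|supp f| + |supp (fourier f)| \<ge> p + 1\<close> for \<open>f \<noteq> 0\<close> (Chebotarev's theorem on the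
  minors of the Fourier matrix). After elimination and division by a power of \<open>1 - \<zeta>\<close>, a
  counterexample yields a polynomial over \<open>\<int>[\<zeta>]\<close> that survives reduction modulo \<open>1 - \<zeta>\<close>; its roots
  all collapse to 1, and over \<open>\<int>\<^sub>p\<close> a nonzero polynomial of degree below \<open>p\<close> with a \<open>k\<close>-fold root 1 has
  more than \<open>k\<close> nonzero coefficients.

  On the plane, let \<open>t\<close> be the number of parallels to a fixed direction that meet the support and \<open>s\<close>
  the least number of support points on such a parallel. Applying the one-dimensional bound twice
  gives \<open>|supp (fourier f)| \<ge> (p + 1 - s) (p + 1 - t)\<close> with \<open>s t \<le> k = |supp f|\<close>. If the support is not
  collinear, the direction through two of its points has \<open>2 \<le> t < k\<close>, whence
  \<open>|supp (fourier f)| \<ge> p (p + 2 - k)\<close>; if it is collinear, \<open>|supp (fourier f)|\<close> is a multiple of \<open>p\<close>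
  and at least \<open>p (p + 1 - k)\<close>. The case \<open>k \<ge> p\<close> follows by applying this dichotomy to the Fourier
  transform.
\<close>

hide_const (open) UnivPoly.coeff UnivPoly.monom Module.smult comm_monoid_mult_class.coprime
no_notation Matrix.vec_index (infixl "$" 100)

section \<open>Vanishing of sparse polynomials at roots of unity\<close>

definition all_one_poly :: "nat \<Rightarrow> 'a::comm_ring_1 poly"
  where "all_one_poly n = (\<Sum>i<n. [:0, 1:] ^ i)"

lemma coeff_all_one_poly: "coeff (all_one_poly n :: 'a::comm_ring_1 poly) i = (if i < n then 1 else 0)"
proof -
  have "[:0, 1 :: 'a:] ^ j = Polynomial.monom 1 j" for j by (simp add: monom_altdef)
  thus ?thesis by (simp add: all_one_poly_def coeff_sum)
qed

lemma linear_mult_all_one_poly: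
  assumes "n > 0"
  shows "[:-1, 1:] * all_one_poly n = ([:0, 1:] ^ n - 1 :: 'a::comm_ring_1 poly)"
proof -
  have "[:-1, 1:] = [:0, 1:] - (1 :: 'a poly)"
    by (rule poly_eqI) (simp add: coeff_pCons split: nat.split)
  thus ?thesis
    using assms power_diff_1_eq[of "[:0, 1::'a:]" n] unfolding all_one_poly_def by (metis not_gr_zero)
qed

lemma degree_all_one_poly: "degree (all_one_poly n :: 'a::comm_ring_1 poly) = n - 1"
proof (rule antisym)
  show "degree (all_one_poly n :: 'a poly) \<le> n - 1"
    by (rule degree_le) (auto simp: coeff_all_one_poly)
  show "n - 1 \<le> degree (all_one_poly n :: 'a poly)"
    by (cases "n = 0") (auto intro!: le_degree simp: coeff_all_one_poly)
qed

lemma lead_coeff_all_one_poly: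
  "n > 0 \<Longrightarrow> lead_coeff (all_one_poly n :: 'a::comm_ring_1 poly) = 1"
  by (simp add: degree_all_one_poly coeff_all_one_poly)

lemma of_int_all_one_poly: "of_int_poly (all_one_poly n) = (all_one_poly n :: 'a::{comm_ring_1} poly)"
  by (rule poly_eqI) (simp add: coeff_all_one_poly)

lemma of_rat_all_one_poly:
  "map_poly of_rat (all_one_poly n) = (all_one_poly n :: 'a::field_char_0 poly)"
  by (rule poly_eqI) (simp add: coeff_map_poly coeff_all_one_poly)

lemma poly_all_one_poly_1: "poly (all_one_poly n) 1 = of_nat n"
  by (simp add: all_one_poly_def poly_sum)

lemma poly_all_one_poly_root:
  assumes "z ^ n = 1" "z \<noteq> (1 :: 'a::idom)" "n > 0"
  shows "poly (all_one_poly n) z = 0"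
proof -
  have "(z - 1) * poly (all_one_poly n) z = poly ([:-1, 1:] * all_one_poly n) z"
    by (simp del: mult_pCons_left)
  also have "\<dots> = 0"
    unfolding linear_mult_all_one_poly[OF assms(3)] using assms by simp
  finally show ?thesis using assms by simp
qed

text \<open>Frobenius is additive; applying it to the sum \<open>(X - 1) + 1\<close> avoids the sign
  \<open>(-1) ^ p\<close>.\<close>

lemma linear_power_CHAR:
  "[:-1, 1 :: 'p::prime_card mod_ring:] ^ CARD('p) = [:0, 1:] ^ CARD('p) - 1"
proof -
  have "([:-1, 1:] + 1 :: 'p mod_ring poly) ^ CARD('p) = [:-1, 1:] ^ CARD('p) + 1 ^ CARD('p)"
    by (rule freshmans_dream) (use prime_card in auto)
  moreover have "[:-1, 1:] + 1 = [:0, 1 :: 'p mod_ring:]"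
    by (rule poly_eqI) (simp add: coeff_pCons split: nat.split)
  ultimately show ?thesis by simp
qed

lemma all_one_poly_CHAR:
  "all_one_poly CARD('p) = [:-1, 1 :: 'p::prime_card mod_ring:] ^ (CARD('p) - 1)"
proof -
  have pos: "CARD('p) > 0" by simp
  have "[:-1, 1 :: 'p mod_ring:] * all_one_poly CARD('p) = [:-1, 1:] * [:-1, 1:] ^ (CARD('p) - 1)"
    unfolding linear_mult_all_one_poly[OF pos] linear_power_CHAR[symmetric]
    using pos by (metis power_eq_if not_gr_zero)
  moreover have "[:-1, 1 :: 'p mod_ring:] \<noteq> 0" by simp
  ultimately show ?thesis by (metis mult_left_cancel)
qed

text \<open>If 1 were not a root, \<open>g\<close> would be coprime to the prime element
  \<open>X - 1\<close>, hence to its powers, hence a unit.\<close>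

lemma linear_power_root:
  fixes g :: "'a::field_gcd poly"
  assumes "g dvd [:-1, 1:] ^ n" "degree g > 0"
  shows "poly g 1 = 0"
proof (rule ccontr)
  assume "poly g 1 \<noteq> 0"
  hence "\<not> [:-1, 1:] dvd g" by (simp add: poly_eq_0_iff_dvd)
  moreover have "prime_elem [:-1, 1 :: 'a:]" by (rule prime_elem_linear_field_poly) simp
  ultimately have "coprime [:-1, 1:] g" by (rule prime_elem_imp_coprime[rotated])
  hence "coprime ([:-1, 1:] ^ n) g" by simp
  hence "is_unit g" using assms(1) by (meson algebraic_semidom_class.coprime_common_divisor dvd_refl)
  with assms(2) show False by (auto simp: is_unit_poly_iff)
qed

text \<open>In a proper factorization both factors reduce modulo \<open>p\<close> to divisors of
  \<open>(X - 1) ^ (p - 1)\<close>, so \<open>p\<close> divides both values at 1; but the product of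
  these values is \<open>p\<close>.\<close>

theorem irreducible_all_one_poly:
  "irreducible\<^sub>d (all_one_poly CARD('p::prime_card) :: int poly)"
proof (rule irreducible\<^sub>dI)
  let ?P = "all_one_poly CARD('p) :: int poly"
  have p2: "CARD('p) \<ge> 2" using prime_card prime_ge_2_nat by blast
  thus "0 < degree ?P" by (simp add: degree_all_one_poly)
  fix g h :: "int poly"
  assume gh: "0 < degree g" "0 < degree h" "?P = g * h"
  have "lead_coeff ?P = 1" by (rule lead_coeff_all_one_poly) simp
  hence lc: "lead_coeff g * lead_coeff h = 1" using gh(3) lead_coeff_mult[of g h] by simp
  have *: "int CARD('p) dvd poly f 1" if f: "f dvd ?P" "0 < degree f" "lead_coeff f dvd 1" for f
  proof -
    let ?f = "of_int_poly f :: 'p mod_ring poly"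
    \<comment> \<open>The leading coefficient is 1 or -1, so the degree stays positive modulo
      \<open>p\<close>.\<close>
    have "of_int (lead_coeff f) \<noteq> (0 :: 'p mod_ring)"
    proof
      assume "of_int (lead_coeff f) = (0 :: 'p mod_ring)"
      moreover have "lead_coeff f = 1 \<or> lead_coeff f = -1"
        using f(3) by (cases "lead_coeff f \<ge> 0") auto
      ultimately show False by auto
    qed
    hence "degree f \<le> degree ?f"
      by (intro le_degree) (simp add: coeff_map_poly)
    hence "degree ?f > 0" using f by simp
    moreover have "?f dvd of_int_poly ?P" using f(1) by (auto elim!: dvdE simp: of_int_poly_hom.hom_mult)
    hence "?f dvd [:-1, 1:] ^ (CARD('p) - 1)" by (simp add: of_int_all_one_poly all_one_poly_CHAR)
    ultimately have "poly ?f 1 = 0" by (rule linear_power_root[rotated])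
    hence "of_int (poly f 1) = (0 :: 'p mod_ring)" by (simp add: of_int_hom.poly_map_poly_1)
    thus ?thesis by (simp add: of_int_eq_0_iff_char_dvd)
  qed
  have "int CARD('p) * int CARD('p) dvd poly g 1 * poly h 1"
    using lc gh by (intro mult_dvd_mono *) (metis dvd_triv_left dvd_triv_right mult.commute)+
  also have "poly g 1 * poly h 1 = int CARD('p)"
    using poly_all_one_poly_1[of "CARD('p)", where ?'a=int] gh(3) by simp
  finally show False using p2 by simp
qed

text \<open>By Gauss's lemma \<open>all_one_poly p\<close> is irreducible over the rationals. A
  nonzero \<open>q\<close> of smaller degree is coprime to it, and a Bezout identity evaluated at
  the common root \<open>z\<close> reads 0 = 1.\<close>

lemma root_of_unity_minimal:
  fixes z :: complex and q :: "int poly"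
  assumes z: "z ^ CARD('p::prime_card) = 1" "z \<noteq> 1"
    and q: "poly (of_int_poly q) z = 0" "degree q < CARD('p) - 1"
  shows "q = 0"
proof (rule ccontr)
  interpret rat_poly: map_poly_comm_ring_hom "of_rat :: rat \<Rightarrow> complex" ..
  assume "q \<noteq> 0"
  let ?P = "of_int_poly (all_one_poly CARD('p)) :: rat poly" and ?q = "of_int_poly q :: rat poly"
  have "irreducible ?P"
    using irreducible\<^sub>d_int_rat[OF irreducible_all_one_poly[where 'p='p]]
    by (simp add: irreducible_connect_field)
  moreover have "\<not> ?P dvd ?q"
  proof
    assume "?P dvd ?q"
    from dvd_imp_degree_le[OF this] \<open>q \<noteq> 0\<close> have "degree ?P \<le> degree ?q" by simp
    thus False using q(2) by (simp add: degree_all_one_poly)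
  qed
  ultimately have cop: "coprime ?P ?q"
    by (simp add: irreducible_imp_prime_elem_gcd prime_elem_imp_coprime)
  obtain u v where "u * ?P + v * ?q = 1"
    using bezout_coefficients_fst_snd[of ?P ?q] cop by (metis coprime_iff_gcd_eq_1)
  hence "poly (map_poly of_rat (u * ?P + v * ?q)) z = 1" by simp
  moreover have "poly (map_poly of_rat ?P) z = 0"
    using poly_all_one_poly_root[OF z] by (simp add: of_int_all_one_poly of_rat_all_one_poly)
  moreover have "poly (map_poly of_rat ?q) z = 0"
    using q by (simp add: map_poly_map_poly o_def)
  ultimately show False by (simp add: rat_poly.hom_add rat_poly.hom_mult)
qed

section \<open>Linear systems over a subring\<close>

text \<open>Gaussian elimination without division, by induction on the set of unknowns.
  \<open>E\<close> is the set of coefficient rows and changes along the induction.\<close>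

lemma homogeneous_system_subring_solution:
  fixes R :: "'a::idom set" and x :: "'i \<Rightarrow> 'a"
  assumes R: "0 \<in> R" "1 \<in> R" "\<And>a b. a \<in> R \<Longrightarrow> b \<in> R \<Longrightarrow> a - b \<in> R"
      "\<And>a b. a \<in> R \<Longrightarrow> b \<in> R \<Longrightarrow> a * b \<in> R"
    and S: "finite S"
  shows "(\<And>e s. e \<in> E \<Longrightarrow> s \<in> S \<Longrightarrow> e s \<in> R) \<Longrightarrow> (\<And>e. e \<in> E \<Longrightarrow> (\<Sum>s\<in>S. e s * x s) = 0) \<Longrightarrow>
    \<exists>s\<in>S. x s \<noteq> 0 \<Longrightarrow>
    \<exists>y. (\<forall>s\<in>S. y s \<in> R) \<and> (\<exists>s\<in>S. y s \<noteq> 0) \<and> (\<forall>e\<in>E. (\<Sum>s\<in>S. e s * y s) = 0)"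
  using S
proof (induction S arbitrary: E rule: finite_induct)
  case (insert s S)
  show ?case
  proof (cases "\<forall>e\<in>E. e s = 0")
    case True
    \<comment> \<open>The unknown \<open>s\<close> occurs in no equation, so the unit vector at
      \<open>s\<close> is a solution.\<close>
    have "(\<Sum>t\<in>insert s S. e t * (if t = s then 1 else 0)) = 0" if "e \<in> E" for e
      using True that insert.hyps by (intro sum.neutral) auto
    thus ?thesis using R by (intro exI[of _ "\<lambda>t. if t = s then 1 else 0"]) auto
  next
    case False
    then obtain e0 where e0: "e0 \<in> E" "e0 s \<noteq> 0" by blast
    \<comment> \<open>Cross-multiplication with the pivot row \<open>e0\<close> cancels the unknown
      \<open>s\<close> and stays in \<open>R\<close>.\<close>
    define elim where "elim e t = e0 s * e t - e s * e0 t" for e t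
    have eq: "e s * x s + (\<Sum>t\<in>S. e t * x t) = 0" if "e \<in> E" for e
      using insert.prems(2)[OF that] insert.hyps by simp
    have "(\<Sum>t\<in>S. elim e t * x t) = 0" if "e \<in> E" for e
    proof -
      have "(\<Sum>t\<in>S. elim e t * x t) = e0 s * (\<Sum>t\<in>S. e t * x t) - e s * (\<Sum>t\<in>S. e0 t * x t)"
        by (simp add: elim_def algebra_simps sum_subtractf sum_distrib_left)
      also have "\<dots> = e0 s * (e s * x s + (\<Sum>t\<in>S. e t * x t)) - e s * (e0 s * x s + (\<Sum>t\<in>S. e0 t * x t))"
        by (simp add: algebra_simps)
      finally show ?thesis using eq[OF that] eq[OF e0(1)] by simp
    qed
    moreover have "\<exists>t\<in>S. x t \<noteq> 0"
    proof (rule ccontr)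
      assume "\<not> ?thesis"
      hence z: "\<forall>t\<in>S. x t = 0" by blast
      hence "x s = 0" using eq[OF e0(1)] e0(2) by simp
      with z insert.prems(3) show False by blast
    qed
    moreover have "elim e t \<in> R" if "e \<in> E" "t \<in> S" for e t
      using that e0 insert.prems(1) R by (auto simp: elim_def)
    ultimately obtain y where y: "\<forall>t\<in>S. y t \<in> R" "\<exists>t\<in>S. y t \<noteq> 0"
        "\<forall>e\<in>E. (\<Sum>t\<in>S. elim e t * y t) = 0"
      using insert.IH[of "elim ` E"] by auto
    \<comment> \<open>Back substitution; scaling by the pivot coefficient \<open>e0 s\<close> takes
      the place of dividing by it.\<close>
    define y' where "y' t = (if t = s then - (\<Sum>t\<in>S. e0 t * y t) else e0 s * y t)" for t
    have neg: "- a \<in> R" if "a \<in> R" for a using R(3)[OF R(1) that] by simp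
    have add: "a + b \<in> R" if "a \<in> R" "b \<in> R" for a b using R(3)[OF that(1) neg[OF that(2)]] by simp
    have "sum f T \<in> R" if "finite T" "\<forall>t\<in>T. f t \<in> R" for T and f :: "'i \<Rightarrow> 'a"
      using that by (induction T rule: finite_induct) (auto intro: add R)
    hence "(\<Sum>t\<in>S. e0 t * y t) \<in> R"
      using insert.hyps insert.prems(1)[OF e0(1)] y(1) R(4) by simp
    hence "\<forall>t\<in>insert s S. y' t \<in> R"
      using neg insert.prems(1)[OF e0(1), of s] y(1) R(4) by (auto simp: y'_def)
    moreover have "\<exists>t\<in>insert s S. y' t \<noteq> 0"
      using y(2) e0 insert.hyps by (auto simp: y'_def)
    moreover have "(\<Sum>t\<in>insert s S. e t * y' t) = 0" if "e \<in> E" for e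
    proof -
      have "(\<Sum>t\<in>S. e t * y' t) = (\<Sum>t\<in>S. e t * (e0 s * y t))"
        using insert.hyps by (intro sum.cong) (auto simp: y'_def)
      hence "(\<Sum>t\<in>insert s S. e t * y' t) = (\<Sum>t\<in>S. elim e t * y t)"
        using insert.hyps
        by (simp add: y'_def elim_def algebra_simps sum_subtractf sum_distrib_left)
      thus ?thesis using y(3) that by simp
    qed
    ultimately show ?thesis by blast
  qed
qed simp

section \<open>Multiplicity of the root 1 over Z_p\<close>

lemma finite_nonzero_coeffs: "finite {i. coeff P i \<noteq> 0}"
  using MOST_coeff_eq_0[of P] by (simp add: eventually_cofinite)

lemma linear_power_dvd_pderiv:
  fixes P :: "'a::idom poly"
  assumes "[:-1, 1:] ^ Suc k dvd P"
  shows "[:-1, 1:] ^ k dvd pderiv P"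
proof -
  obtain G where G: "P = [:-1, 1:] ^ Suc k * G" using assms by (elim dvdE)
  have "[:-1, 1:] ^ k dvd [:-1, 1:] ^ Suc k * pderiv G"
    by (intro dvd_mult2 le_imp_power_dvd) simp
  moreover have "[:-1, 1:] ^ k dvd pderiv ([:-1, 1:] ^ Suc k) * G"
    unfolding pderiv_power_Suc by (intro dvd_mult2 dvd_smult) simp
  ultimately show ?thesis unfolding G pderiv_mult by (metis dvd_add mult.commute)
qed

text \<open>The operator \<open>X d/dX - i\<close> deletes exactly the \<open>i\<close>-th coefficient, because the exponents are
  distinct modulo \<open>p\<close>, and lowers the multiplicity of the root 1 by at most one.\<close>
lemma multiplicity_one_less_card_coeffs:
  fixes P :: "'p::prime_card mod_ring poly"
  shows "P \<noteq> 0 \<Longrightarrow> degree P < CARD('p) \<Longrightarrow> [:-1, 1:] ^ k dvd P \<Longrightarrow> k < card {i. coeff P i \<noteq> 0}"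
proof (induction k arbitrary: P)
  case 0
  have "finite {i. coeff P i \<noteq> 0}" by (rule finite_nonzero_coeffs)
  moreover have "degree P \<in> {i. coeff P i \<noteq> 0}" using 0 by simp
  ultimately show ?case by (metis card_gt_0_iff empty_iff)
next
  case (Suc k)
  define i0 where "i0 = degree P"
  define Q where "Q = [:0, 1:] * pderiv P - smult (of_nat i0) P"
  have i0: "coeff P i0 \<noteq> 0" using Suc.prems by (simp add: i0_def)
  have coeffQ: "coeff Q i = (of_nat i - of_nat i0) * coeff P i" for i
    by (cases i) (simp_all add: Q_def coeff_pCons coeff_pderiv algebra_simps)
  have fin: "finite {i. coeff P i \<noteq> 0}" by (rule finite_nonzero_coeffs)
  have inj: "of_nat i = (of_nat i0 :: 'p mod_ring) \<longleftrightarrow> i = i0" if "coeff P i \<noteq> 0" for i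
  proof -
    have "i < CARD('p)" "i0 < CARD('p)" using that Suc.prems(2) le_degree[OF that] by (auto simp: i0_def)
    moreover have "of_nat i = (of_nat i0 :: 'p mod_ring) \<longleftrightarrow> [i = i0] (mod CARD('p))"
      by (simp add: of_nat_eq_iff_cong_CHAR)
    ultimately show ?thesis by (metis cong_def mod_less)
  qed
  have suppQ: "{i. coeff Q i \<noteq> 0} = {i. coeff P i \<noteq> 0} - {i0}"
    using inj by (auto simp: coeffQ)
  have "[:-1, 1:] ^ k dvd P" using Suc.prems(3) by (metis dvd_trans le_imp_power_dvd le_SucI order_refl)
  hence dvdQ: "[:-1, 1:] ^ k dvd Q"
    unfolding Q_def by (intro dvd_diff dvd_mult dvd_smult linear_power_dvd_pderiv Suc.prems(3))
  \<comment> \<open>Otherwise \<open>P\<close> would be a single monomial, which does not vanish at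
    1 although \<open>X - 1\<close> divides \<open>P\<close>.\<close>
  have "Q \<noteq> 0"
  proof
    assume "Q = 0"
    hence "{i. coeff P i \<noteq> 0} \<subseteq> {i0}" using suppQ by auto
    hence "P = Polynomial.monom (coeff P i0) i0" by (intro poly_eqI) auto
    moreover have "poly P 1 = 0" using Suc.prems(3) by (simp add: poly_eq_0_iff_dvd dvd_mult_left)
    ultimately have "coeff P i0 = 0" by (metis poly_monom power_one mult.right_neutral)
    with i0 show False by simp
  qed
  moreover have "degree Q < CARD('p)"
  proof -
    have "degree Q \<le> degree P" by (rule degree_le) (simp add: coeffQ coeff_eq_0)
    thus ?thesis using Suc.prems(2) by simp
  qed
  ultimately have "k < card {i. coeff Q i \<noteq> 0}" using Suc.IH dvdQ by blast
  thus ?case unfolding suppQ using fin i0 by (simp add: card_Diff_singleton)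
qed

section \<open>The ring Z[z] and its reduction modulo \<open>1 - z\<close>\<close>

locale root_of_unity =
  fixes z :: complex and p :: "'p::prime_card itself"
  assumes z_power: "z ^ CARD('p) = 1" and z_neq_1: "z \<noteq> 1"
begin

text \<open>The range is Z[z]. Its elements are handled through integer polynomials \<open>q\<close>
  because the residue modulo \<open>z - 1\<close> can then be read off as \<open>poly q 1\<close>
  modulo \<open>p\<close>.\<close>

definition at_root :: "int poly \<Rightarrow> complex"
  where "at_root q = poly (of_int_poly q) z"

sublocale at_root: comm_ring_hom at_root
  by unfold_locales (simp_all add: at_root_def of_int_poly_hom.hom_add of_int_poly_hom.hom_mult)

lemma p_ge_2: "CARD('p) \<ge> 2"
  using prime_card prime_ge_2_nat by blast

lemma at_root_all_one_poly: "at_root (all_one_poly CARD('p)) = 0"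
  using poly_all_one_poly_root[OF z_power z_neq_1] by (simp add: at_root_def of_int_all_one_poly)

lemma at_root_linear: "at_root [:-1, 1:] = z - 1"
  by (simp add: at_root_def)

text \<open>Supplies representatives of degree below \<open>p - 1\<close>. Pseudo-division is exact
  because the divisor is monic.\<close>

lemma all_one_poly_division:
  obtains s r where "q = all_one_poly CARD('p) * s + r" "degree r < CARD('p) - 1" "at_root r = at_root q"
proof -
  let ?P = "all_one_poly CARD('p) :: int poly"
  obtain s r where sr: "pseudo_divmod q ?P = (s, r)" by fastforce
  have lc: "lead_coeff ?P = 1" by (rule lead_coeff_all_one_poly) simp
  hence P0: "?P \<noteq> 0" by auto
  have eq: "q = ?P * s + r" using pseudo_divmod(1)[OF P0 sr] lc by simp
  moreover have "r = 0 \<or> degree r < degree ?P" using pseudo_divmod(2)[OF P0 sr] .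
  hence "degree r < CARD('p) - 1" using p_ge_2 by (auto simp: degree_all_one_poly)
  moreover have "at_root q = at_root r"
    by (simp add: eq at_root.hom_add at_root.hom_mult at_root_all_one_poly)
  ultimately show ?thesis using that by simp
qed

text \<open>Makes the residue depend only on the element of Z[z]: the remainder of \<open>q\<close>
  is 0 by minimality, so \<open>q\<close> is a multiple of \<open>all_one_poly p\<close>, whose
  value at 1 is \<open>p\<close>.\<close>

lemma at_root_eq_0D: "at_root q = 0 \<Longrightarrow> int CARD('p) dvd poly q 1"
proof -
  assume q: "at_root q = 0"
  obtain s r where sr: "q = all_one_poly CARD('p) * s + r" "degree r < CARD('p) - 1" "at_root r = at_root q"
    by (rule all_one_poly_division)
  have "r = 0" using root_of_unity_minimal[where 'p='p, OF z_power z_neq_1, of r] sr q by (simp add: at_root_def)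
  thus ?thesis using sr(1) by (simp add: poly_all_one_poly_1)
qed

text \<open>The kernel of the reduction is generated by \<open>z - 1\<close>: \<open>q\<close>
  differs from its value at 1 by a multiple of \<open>X - 1\<close>, and \<open>p\<close> itself is
  a multiple of \<open>z - 1\<close>.\<close>

lemma at_root_divisible:
  assumes "int CARD('p) dvd poly q 1"
  obtains q' where "at_root q = (z - 1) * at_root q'"
proof -
  let ?P = "all_one_poly CARD('p) :: int poly"
  obtain n where n: "poly q 1 = int CARD('p) * n" using assms by (elim dvdE)
  define s where "s = synthetic_div q 1"
  define u where "u = synthetic_div ?P 1"
  have const: "at_root [:c:] = of_int c" for c by (simp add: at_root_def of_int_hom.map_poly_pCons_hom del: one_poly_eq_simps)
  \<comment> \<open>Evaluated at \<open>z\<close>, this exhibits \<open>p\<close> as a multiple of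
    \<open>z - 1\<close>.\<close>
  have "?P = [:-1, 1:] * u + [:int CARD('p):]"
    using synthetic_div_correct'[of 1 ?P] by (simp add: u_def poly_all_one_poly_1)
  hence "0 = at_root ([:-1, 1:] * u + [:int CARD('p):])" using at_root_all_one_poly by simp
  hence P: "of_nat CARD('p) = - ((z - 1) * at_root u)"
    by (simp only: at_root.hom_add at_root.hom_mult at_root_linear const) (simp add: eq_neg_iff_add_eq_0 add.commute)
  have "q = [:-1, 1:] * s + [:int CARD('p) * n:]"
    using synthetic_div_correct'[of 1 q] by (simp add: s_def n)
  hence "at_root q = (z - 1) * at_root s + of_nat CARD('p) * of_int n"
    by (simp only: at_root.hom_add at_root.hom_mult at_root_linear const) simp
  also have "\<dots> = (z - 1) * at_root (s - u * [:n:])"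
    unfolding P by (simp only: at_root.hom_minus at_root.hom_mult const) (simp add: algebra_simps)
  finally show ?thesis by (rule that)
qed

text \<open>\<open>(X - 1) ^ p\<close> and \<open>X ^ p - 1\<close> agree modulo \<open>p\<close> by
  Frobenius, and the latter vanishes at \<open>z\<close>.\<close>

lemma linear_power_at_root: obtains h where "(z - 1) ^ CARD('p) = of_nat CARD('p) * at_root h"
proof -
  define g :: "int poly" where "g = [:-1, 1:] ^ CARD('p) - ([:0, 1:] ^ CARD('p) - 1)"
  have "of_int_poly g = (0 :: 'p mod_ring poly)"
    using linear_power_CHAR[where 'p='p]
    by (simp add: g_def of_int_poly_hom.hom_minus of_int_poly_hom.hom_power)
  hence "of_int (coeff g i) = (0 :: 'p mod_ring)" for i by (metis of_int_hom.coeff_map_poly_hom coeff_0)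
  hence dvd: "int CARD('p) dvd coeff g i" for i by (simp add: of_int_eq_0_iff_char_dvd)
  hence "[:int CARD('p):] dvd g" by (simp add: const_poly_dvd_iff)
  then obtain h where "g = [:int CARD('p):] * h" by (elim dvdE)
  hence "at_root g = of_nat CARD('p) * at_root h"
    by (simp only: at_root.hom_mult) (simp add: at_root_def)
  moreover have "at_root g = (z - 1) ^ CARD('p)"
    unfolding g_def by (simp only: at_root.hom_minus at_root.hom_power at_root_linear at_root.hom_one)
      (simp add: at_root_def z_power)
  ultimately show ?thesis using that by simp
qed

text \<open>Divisibility by all powers of \<open>z - 1\<close> gives divisibility by all powers of
  \<open>p\<close>. Since representatives of degree below \<open>p - 1\<close> are unique, this
  passes to the leading coefficient, a nonzero integer.\<close>

lemma not_infinitely_divisible: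
  assumes "at_root q \<noteq> 0"
  shows "\<exists>n. \<forall>s. at_root q \<noteq> (z - 1) ^ n * at_root s"
proof (rule ccontr)
  assume "\<not> ?thesis"
  hence all: "\<exists>s. at_root q = (z - 1) ^ n * at_root s" for n by blast
  obtain r where r: "degree r < CARD('p) - 1" "at_root r = at_root q"
    using all_one_poly_division[of q] by metis
  obtain h where h: "(z - 1) ^ CARD('p) = of_nat CARD('p) * at_root h" by (rule linear_power_at_root)
  have "int CARD('p) ^ n dvd lead_coeff r" for n
  proof -
    obtain s where s: "at_root q = (z - 1) ^ (CARD('p) * n) * at_root s" using all by blast
    also have "\<dots> = of_nat CARD('p) ^ n * at_root (h ^ n * s)"
      by (simp add: power_mult h power_mult_distrib at_root.hom_mult at_root.hom_power)
    finally obtain t where t: "degree t < CARD('p) - 1" "at_root q = of_nat CARD('p) ^ n * at_root t"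
      using all_one_poly_division[of "h ^ n * s"] by metis
    have "at_root (r - [:int CARD('p) ^ n:] * t) = 0"
      using t r by (simp only: at_root.hom_minus at_root.hom_mult) (simp add: at_root_def)
    moreover have "degree (r - [:int CARD('p) ^ n:] * t) < CARD('p) - 1"
      using r(1) t(1) by (intro degree_diff_less) auto
    ultimately have "r - [:int CARD('p) ^ n:] * t = 0"
      unfolding at_root_def by (intro root_of_unity_minimal[where 'p='p, OF z_power z_neq_1])
    hence "coeff r (degree r) = int CARD('p) ^ n * coeff t (degree r)"
      by (simp add: poly_eq_iff)
    thus ?thesis by simp
  qed
  moreover have "lead_coeff r \<noteq> 0" using r assms by (auto simp: at_root_def)
  ultimately have "int CARD('p) ^ n \<le> \<bar>lead_coeff r\<bar>" for n
    by (meson dvd_imp_le_int order_trans abs_ge_self zdvd_imp_le zero_less_abs_iff dvd_abs_iff)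
  \<comment> \<open>The exponent \<open>n\<close> is the absolute value of the leading coefficient,
    because \<open>p ^ n > n\<close>.\<close>
  hence "int CARD('p) ^ nat \<bar>lead_coeff r\<bar> \<le> int (nat \<bar>lead_coeff r\<bar>)" by simp
  moreover have "int n < int CARD('p) ^ n" for n
    using of_nat_less_two_power[of n, where ?'a=int] power_mono[of 2 "int CARD('p)" n] p_ge_2 by linarith
  ultimately show False by (metis not_less)
qed

text \<open>Once the largest common power of \<open>z - 1\<close> is extracted, no common factor
  \<open>z - 1\<close> remains, so by \<open>at_root_divisible\<close> some quotient survives the
  reduction.\<close>

lemma common_divisor_at_root:
  fixes q :: "'i \<Rightarrow> int poly"
  assumes "at_root (q i) \<noteq> 0"
  obtains m q' where "\<And>i. at_root (q i) = (z - 1) ^ m * at_root (q' i)"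
    and "\<exists>i. \<not> int CARD('p) dvd poly (q' i) 1"
proof -
  \<comment> \<open>The exponents of common powers; they are bounded because the entry at
    \<open>i\<close> is nonzero.\<close>
  define D where "D = {m. \<exists>q'. \<forall>i. at_root (q i) = (z - 1) ^ m * at_root (q' i)}"
  obtain n where n: "\<forall>s. at_root (q i) \<noteq> (z - 1) ^ n * at_root s"
    using not_infinitely_divisible[OF assms] by blast
  have "m < n" if "m \<in> D" for m
  proof (rule ccontr)
    assume "\<not> m < n"
    hence "(z - 1) ^ m = (z - 1) ^ n * (z - 1) ^ (m - n)" by (simp flip: power_add)
    also have "(z - 1) ^ (m - n) = at_root ([:-1, 1:] ^ (m - n))"
      by (simp only: at_root.hom_power at_root_linear)
    finally have "(z - 1) ^ m = (z - 1) ^ n * at_root ([:-1, 1:] ^ (m - n))" .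
    moreover obtain q' where "at_root (q i) = (z - 1) ^ m * at_root (q' i)"
      using \<open>m \<in> D\<close> by (auto simp: D_def)
    ultimately have "at_root (q i) = (z - 1) ^ n * at_root ([:-1, 1:] ^ (m - n) * q' i)"
      by (simp add: at_root.hom_mult mult.assoc)
    with n show False by blast
  qed
  hence fin: "finite D" by (meson finite_lessThan finite_subset lessThan_iff subsetI)
  have "0 \<in> D" by (auto simp: D_def)
  hence "Max D \<in> D" using fin by (intro Max_in) auto
  then obtain q' where q': "\<And>i. at_root (q i) = (z - 1) ^ Max D * at_root (q' i)" by (auto simp: D_def)
  have "\<exists>i. \<not> int CARD('p) dvd poly (q' i) 1"
  proof (rule ccontr)
    assume "\<not> ?thesis"
    hence "\<exists>r. at_root (q' i) = (z - 1) * at_root r" for i using at_root_divisible by blast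
    then obtain r where r: "\<And>i. at_root (q' i) = (z - 1) * at_root (r i)" by metis
    have "at_root (q i) = (z - 1) ^ Suc (Max D) * at_root (r i)" for i
      unfolding q'[of i] r[of i] by simp
    hence "Suc (Max D) \<in> D" unfolding D_def by blast
    hence "Suc (Max D) \<le> Max D" using fin by (rule Max_ge[rotated])
    thus False by simp
  qed
  with q' show ?thesis by (rule that)
qed

section \<open>Collapsing roots and the number of nonzero coefficients\<close>

definition at_root_poly :: "int poly poly \<Rightarrow> complex poly"
  where "at_root_poly = map_poly at_root"

text \<open>The coefficients are integer polynomials: \<open>at_root_poly\<close> evaluates them in
  Z[z], and this map takes their residues modulo \<open>z - 1\<close>.\<close>

definition at_one_poly :: "int poly poly \<Rightarrow> 'p mod_ring poly"
  where "at_one_poly = map_poly (\<lambda>q. of_int (poly q 1))"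

text \<open>A factor \<open>Y - X ^ b\<close> splits off up to a remainder that vanishes at
  \<open>z\<close> and hence also after reduction, where the factor becomes \<open>Y - 1\<close>
  whatever \<open>b\<close> is. Distinctness of the roots lets the others pass to the
  quotient.\<close>

lemma roots_imp_multiplicity_at_one:
  assumes "finite B"
  shows "inj_on (\<lambda>b. z ^ b) B \<Longrightarrow> (\<And>b. b \<in> B \<Longrightarrow> poly (at_root_poly P) (z ^ b) = 0) \<Longrightarrow>
    [:-1, 1:] ^ card B dvd at_one_poly P"
  using assms
proof (induction B arbitrary: P rule: finite_induct)
  case (insert b B)
  interpret R: map_poly_comm_ring_hom at_root ..
  interpret O1: comm_ring_hom "\<lambda>q. of_int (poly q 1) :: 'p mod_ring"
    by unfold_locales auto
  interpret O: map_poly_comm_ring_hom "\<lambda>q. of_int (poly q 1) :: 'p mod_ring" ..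
  define w :: "int poly" where "w = [:0, 1:] ^ b"
  define T where "T = synthetic_div P w"
  define r where "r = poly P w"
  have P: "P = [:-w, 1:] * T + [:r:]" using synthetic_div_correct'[of w P] by (simp add: T_def r_def)
  have w: "at_root w = z ^ b" "poly w 1 = 1"
    by (simp_all add: w_def at_root.hom_power) (simp add: at_root_def)
  have "at_root r = 0"
    using insert.prems(2)[of b] at_root.poly_map_poly[of P w] by (simp add: r_def w at_root_poly_def)
  hence "int CARD('p) dvd poly r 1" by (rule at_root_eq_0D)
  hence r1: "of_int (poly r 1) = (0 :: 'p mod_ring)" by (simp add: of_int_eq_0_iff_char_dvd)
  have PT: "at_root_poly P = [:- (z ^ b), 1:] * at_root_poly T"
    unfolding at_root_poly_def P R.hom_add R.hom_mult
    by (simp add: at_root.map_poly_pCons_hom w \<open>at_root r = 0\<close> at_root.hom_uminus)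
  have PO: "at_one_poly P = [:-1, 1:] * at_one_poly T"
    unfolding at_one_poly_def P O.hom_add O.hom_mult by (simp add: O1.map_poly_pCons_hom w r1)
  have "poly (at_root_poly T) (z ^ c) = 0" if "c \<in> B" for c
  proof -
    have "(z ^ c - z ^ b) * poly (at_root_poly T) (z ^ c) = 0"
      using insert.prems(2)[of c] that by (simp add: PT algebra_simps)
    moreover have "z ^ c \<noteq> z ^ b" using insert.prems(1) that insert.hyps by (auto simp: inj_on_def)
    ultimately show ?thesis by simp
  qed
  hence "[:-1, 1:] ^ card B dvd at_one_poly T"
    using insert.prems(1) by (intro insert.IH) (auto simp: inj_on_def)
  thus ?case unfolding PO card_insert_disjoint[OF insert.hyps] power_Suc by (intro mult_dvd_mono dvd_refl)
qed simp

text \<open>Chebotarev's theorem on Fourier minors in polynomial form.\<close>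

theorem card_roots_less_card_coeffs:
  fixes C :: "complex poly"
  assumes "C \<noteq> 0" "degree C < CARD('p)" "finite B" "inj_on (\<lambda>b. z ^ b) B"
    and roots: "\<And>b. b \<in> B \<Longrightarrow> poly C (z ^ b) = 0"
  shows "card B < card {i. coeff C i \<noteq> 0}"
proof -
  define S where "S = {i. coeff C i \<noteq> 0}"
  have finS: "finite S" unfolding S_def by (rule finite_nonzero_coeffs)
  \<comment> \<open>One homogeneous equation per root; the unknowns are the coefficients in the
    support of \<open>C\<close>.\<close>
  define E where "E = (\<lambda>b s. (z ^ b) ^ s) ` B"
  have sumS: "(\<Sum>s\<in>S. f s * coeff C s) = (\<Sum>s\<le>degree C. f s * coeff C s)" for f
    by (intro sum.mono_neutral_left) (simp_all add: S_def le_degree subset_iff)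
  have pow: "(z ^ b) ^ s \<in> range at_root" for b s
  proof
    show "(z ^ b) ^ s = at_root (([:0, 1:] ^ b) ^ s)"
      by (simp only: at_root.hom_power) (simp add: at_root_def)
  qed simp
  \<comment> \<open>The coefficients can be replaced by elements of Z[z] without enlarging the
    support or losing a root.\<close>
  have "\<exists>y. (\<forall>s\<in>S. y s \<in> range at_root) \<and> (\<exists>s\<in>S. y s \<noteq> 0) \<and> (\<forall>e\<in>E. (\<Sum>s\<in>S. e s * y s) = 0)"
  proof (rule homogeneous_system_subring_solution[where x = "coeff C"])
    show "0 \<in> range at_root" by (metis at_root.hom_zero rangeI)
    show "1 \<in> range at_root" by (metis at_root.hom_one rangeI)
    show "a - b \<in> range at_root" if "a \<in> range at_root" "b \<in> range at_root" for a b
      using that by (auto simp flip: at_root.hom_minus)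
    show "a * b \<in> range at_root" if "a \<in> range at_root" "b \<in> range at_root" for a b
      using that by (auto simp flip: at_root.hom_mult)
    show "\<exists>s\<in>S. coeff C s \<noteq> 0" using assms(1) by (auto simp: S_def intro!: exI[of _ "degree C"])
    show "(\<Sum>s\<in>S. e s * coeff C s) = 0" if "e \<in> E" for e
      using that roots unfolding sumS by (auto simp: E_def poly_altdef mult.commute)
  qed (use pow finS in \<open>auto simp: E_def\<close>)
  then obtain y where y: "\<forall>s\<in>S. y s \<in> range at_root" "\<exists>s\<in>S. y s \<noteq> 0"
      "\<forall>e\<in>E. (\<Sum>s\<in>S. e s * y s) = 0" by blast
  \<comment> \<open>The default 0 off \<open>S\<close> is what later places the surviving index
    \<open>j\<close> in \<open>S\<close>.\<close>
  define q where "q s = (if s \<in> S then inv_into UNIV at_root (y s) else 0)" for s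
  have q: "at_root (q s) = y s" if "s \<in> S" for s
    using that y(1) by (simp add: q_def f_inv_into_f)
  obtain i where "at_root (q i) \<noteq> 0" using y(2) q by metis
  from common_divisor_at_root[of q, OF this] obtain m q'
    where q': "\<And>i. at_root (q i) = (z - 1) ^ m * at_root (q' i)"
      "\<exists>i. \<not> int CARD('p) dvd poly (q' i) 1" by metis
  define P where "P = (\<Sum>s\<in>S. Polynomial.monom (q' s) s)"
  have coeffP: "coeff P i = (if i \<in> S then q' i else 0)" for i
    using finS by (simp add: P_def coeff_sum)
  interpret O1: comm_ring_hom "\<lambda>q. of_int (poly q 1) :: 'p mod_ring"
    by unfold_locales auto
  have coeff1: "coeff (at_one_poly P) i = (if i \<in> S then of_int (poly (q' i) 1) else 0)" for i
    by (simp add: at_one_poly_def O1.coeff_map_poly_hom coeffP)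
  obtain j where j: "\<not> int CARD('p) dvd poly (q' j) 1" using q'(2) by blast
  have "j \<in> S"
  proof (rule ccontr)
    assume "j \<notin> S"
    hence "at_root (q' j) = 0" using q'(1)[of j] z_neq_1 by (simp add: q_def)
    with j show False using at_root_eq_0D by blast
  qed
  hence "coeff (at_one_poly P) j \<noteq> 0" using j by (simp add: coeff1 of_int_eq_0_iff_char_dvd)
  hence nz: "at_one_poly P \<noteq> 0" by auto
  have deg: "degree (at_one_poly P) < CARD('p)"
  proof -
    have "degree (at_one_poly P) \<le> degree C" by (rule degree_le) (simp add: coeff1 S_def coeff_eq_0)
    thus ?thesis using assms(2) by simp
  qed
  have "[:-1, 1:] ^ card B dvd at_one_poly P"
  proof (rule roots_imp_multiplicity_at_one)
    fix b assume b: "b \<in> B"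
    interpret R: map_poly_comm_ring_hom at_root ..
    \<comment> \<open>Multiplying by the extracted power restores \<open>y\<close>, which solves the
      equation of this root.\<close>
    have "(z - 1) ^ m * poly (at_root_poly P) (z ^ b) = (\<Sum>s\<in>S. (z - 1) ^ m * (at_root (q' s) * (z ^ b) ^ s))"
      by (simp add: at_root_poly_def P_def R.hom_sum poly_sum map_poly_monom poly_monom sum_distrib_left)
    also have "\<dots> = (\<Sum>s\<in>S. (z ^ b) ^ s * y s)"
      using q by (intro sum.cong refl) (metis mult.assoc mult.commute q'(1))
    also have "\<dots> = 0" using y(3) b by (auto simp: E_def)
    finally show "poly (at_root_poly P) (z ^ b) = 0" using z_neq_1 by simp
  qed (use assms in auto)
  from multiplicity_one_less_card_coeffs[OF nz deg this]
  have "card B < card {i. coeff (at_one_poly P) i \<noteq> 0}" .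
  also have "\<dots> \<le> card S" using finS by (intro card_mono) (auto simp: coeff1)
  finally show ?thesis by (simp add: S_def)
qed

end

section \<open>The Fourier transform on \<open>\<int>\<^sub>p\<close>\<close>

definition std_char :: "'p::prime_card mod_ring \<Rightarrow> complex"
  where "std_char x = exp (2 * of_real pi * \<i> * of_int (to_int_mod_ring x) / of_nat CARD('p))"

text \<open>Any natural representative may stand in the exponent, which turns additivity into a
  property of \<open>exp\<close>.\<close>

lemma std_char_of_nat:
  "std_char (of_nat n :: 'p::prime_card mod_ring) = exp (2 * of_real pi * \<i> * of_nat n / of_nat CARD('p))"
proof -
  have "to_int_mod_ring (of_nat n :: 'p mod_ring) = int n mod int CARD('p)"
    by (metis of_int_of_int_mod_ring of_int_mod_ring.rep_eq of_int_of_nat_eq to_int_mod_ring.rep_eq)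
  hence "std_char (of_nat n :: 'p mod_ring) =
      exp (2 * of_real pi * \<i> * of_nat (n mod CARD('p)) / of_nat CARD('p))"
    by (simp add: std_char_def flip: zmod_int)
  also have "\<dots> = exp (2 * of_real pi * \<i> * of_nat n / of_nat CARD('p))"
    unfolding complex_root_unity_eq[of "CARD('p)" "n mod CARD('p)" n, OF zero_less_card_finite[THEN Suc_leI, unfolded One_nat_def[symmetric]]]
    by (simp add: cong_def)
  finally show ?thesis .
qed

lemma of_nat_mod_ring_cases:
  obtains n where "n < CARD('p)" "x = (of_nat n :: 'p::prime_card mod_ring)"
  using surj_of_nat_mod_ring[of x] by blast

lemma bij_of_nat_mod_ring: "bij_betw of_nat {..<CARD('p)} (UNIV :: 'p::prime_card mod_ring set)"
proof -
  have "inj_on (of_nat :: nat \<Rightarrow> 'p mod_ring) {..<CARD('p)}"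
    by (auto simp: inj_on_def of_nat_eq_iff_cong_CHAR cong_def)
  moreover have "x \<in> of_nat ` {..<CARD('p)}" for x :: "'p mod_ring"
    by (rule of_nat_mod_ring_cases[of x]) auto
  hence "of_nat ` {..<CARD('p)} = (UNIV :: 'p mod_ring set)" by blast
  ultimately show ?thesis by (simp add: bij_betw_def)
qed

lemma std_char_add: "std_char (x + y) = std_char x * std_char (y :: 'p::prime_card mod_ring)"
proof -
  obtain m n where mn: "x = of_nat m" "y = of_nat n" by (metis of_nat_mod_ring_cases)
  show ?thesis
    unfolding mn std_char_of_nat of_nat_add[symmetric] exp_add[symmetric]
    by (simp add: add_divide_distrib distrib_left)
qed

lemma std_char_0: "std_char (0 :: 'p::prime_card mod_ring) = 1"
  using std_char_of_nat[of 0, where 'p='p] by simp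

lemma std_char_of_nat_mult:
  "std_char (of_nat n * x :: 'p::prime_card mod_ring) = std_char x ^ n"
  by (induction n) (simp_all add: std_char_0 std_char_add distrib_right)

lemma std_char_nonzero: "std_char x \<noteq> 0"
  by (simp add: std_char_def)

lemma norm_std_char: "cmod (std_char x) = 1"
proof -
  have "2 * of_real pi * \<i> * of_int (to_int_mod_ring x) / of_nat CARD('a) =
      \<i> * of_real (2 * pi * of_int (to_int_mod_ring x) / of_nat CARD('a))" by simp
  thus ?thesis unfolding std_char_def by (simp only: norm_exp_i_times)
qed

lemma std_char_inj: "inj (std_char :: 'p::prime_card mod_ring \<Rightarrow> complex)"
proof
  fix x y :: "'p mod_ring" assume eq: "std_char x = std_char y"
  obtain m n where mn: "x = of_nat m" "m < CARD('p)" "y = of_nat n" "n < CARD('p)"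
    by (metis of_nat_mod_ring_cases)
  have "CARD('p) \<ge> 1" by (simp add: Suc_leI)
  hence "m mod CARD('p) = n mod CARD('p)"
    using eq complex_root_unity_eq[of "CARD('p)" m n] unfolding mn std_char_of_nat by (simp add: cong_def)
  thus "x = y" using mn by simp
qed

lemma std_char_eq_1_iff: "std_char (x :: 'p::prime_card mod_ring) = 1 \<longleftrightarrow> x = 0"
  using std_char_inj std_char_0 by (metis injD)

interpretation std_root: root_of_unity "std_char (1 :: 'p::prime_card mod_ring)" "TYPE('p)"
proof
  show "std_char (1 :: 'p mod_ring) ^ CARD('p) = 1"
    using std_char_of_nat_mult[of "CARD('p)" "1 :: 'p mod_ring"] by (simp add: std_char_0)
  show "std_char (1 :: 'p mod_ring) \<noteq> 1" by (simp add: std_char_eq_1_iff)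
qed

lemma sum_std_char:
  "(\<Sum>y\<in>UNIV. std_char (c * y :: 'p::prime_card mod_ring)) = (if c = 0 then of_nat CARD('p) else 0)"
proof (cases "c = 0")
  case False
  \<comment> \<open>Shifting the variable by 1 multiplies the sum by \<open>std_char c\<close>,
    which is not 1.\<close>
  have "(\<Sum>y\<in>UNIV. std_char (c * y)) = (\<Sum>y\<in>UNIV. std_char (c * (y + 1)))"
    by (rule sum.reindex_bij_witness[of _ "\<lambda>y. y + 1" "\<lambda>y. y - 1"]) auto
  also have "\<dots> = std_char c * (\<Sum>y\<in>UNIV. std_char (c * y))"
    by (simp add: distrib_left std_char_add sum_distrib_left mult.commute)
  finally have "(1 - std_char c) * (\<Sum>y\<in>UNIV. std_char (c * y)) = 0" by (simp add: algebra_simps)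
  with False show ?thesis by (simp add: std_char_eq_1_iff)
qed (simp add: std_char_0)

lemma supp_eq: "supp f = {x. f x \<noteq> 0}"
  by (simp add: support_on_def)

lemma characters_of_nat_mult:
  assumes "\<psi> \<in> characters"
  shows "\<psi> 0 = 1" "\<psi> (of_nat n * x :: 'p::prime_card mod_ring) = \<psi> x ^ n"
proof -
  have add: "\<psi> (x + y) = \<psi> x * \<psi> y" for x y using assms by (simp add: characters_def)
  have "cmod (\<psi> 0) = 1" using assms by (simp add: characters_def)
  hence "\<psi> 0 \<noteq> 0" by auto
  thus 0: "\<psi> 0 = 1" using add[of 0 0] by simp
  show "\<psi> (of_nat n * x) = \<psi> x ^ n" by (induction n) (simp_all add: 0 add distrib_right)
qed

text \<open>A character is determined by its value at the generator 1, a \<open>p\<close>-th root of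
  unity.\<close>

lemma characters_mod_ring:
  "(characters :: ('p::prime_card mod_ring \<Rightarrow> complex) set) = range (\<lambda>y x. std_char (x * y))"
proof
  show "range (\<lambda>y x. std_char (x * y)) \<subseteq> (characters :: ('p mod_ring \<Rightarrow> complex) set)"
    by (auto simp: characters_def norm_std_char std_char_add distrib_right)
  show "(characters :: ('p mod_ring \<Rightarrow> complex) set) \<subseteq> range (\<lambda>y x. std_char (x * y))"
  proof
    fix \<psi> :: "'p mod_ring \<Rightarrow> complex" assume \<psi>: "\<psi> \<in> characters"
    have "\<psi> 1 ^ CARD('p) = 1"
      using characters_of_nat_mult(2)[OF \<psi>, of "CARD('p)" 1] characters_of_nat_mult(1)[OF \<psi>] by simp
    moreover have "CARD('p) \<ge> 1" by (simp add: Suc_leI)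
    ultimately obtain j where j: "\<psi> 1 = exp (2 * of_real pi * \<i> * of_nat j / of_nat CARD('p))"
      using complex_roots_unity[of "CARD('p)"] by blast
    have "\<psi> x = std_char (x * of_nat j)" for x
    proof -
      obtain n where n: "x = of_nat n" by (rule of_nat_mod_ring_cases)
      show ?thesis
        using characters_of_nat_mult(2)[OF \<psi>, of n 1] j
        unfolding n std_char_of_nat_mult std_char_of_nat by simp
    qed
    thus "\<psi> \<in> range (\<lambda>y x. std_char (x * y))" by blast
  qed
qed

text \<open>The one-dimensional counterpart of \<open>plane_fourier\<close>: the transform read on
  the group itself.\<close>

definition mod_fourier :: "('p::prime_card mod_ring \<Rightarrow> complex) \<Rightarrow> 'p mod_ring \<Rightarrow> complex"
  where "mod_fourier g y = (\<Sum>x\<in>UNIV. g x * std_char (- (x * y)))"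

lemma card_fourier_supp_mod_ring:
  fixes g :: "'p::prime_card mod_ring \<Rightarrow> complex"
  shows "card (fourier_supp g) = card (supp (mod_fourier g))"
proof -
  have "inj (\<lambda>y x :: 'p mod_ring. std_char (x * y))"
    by (rule injI) (metis injD mult_1 std_char_inj)
  moreover have "fourier_supp g = (\<lambda>y x. std_char (x * y)) ` supp (mod_fourier g)"
    by (auto simp: support_on_def characters_mod_ring fourier_def mod_fourier_def)
  ultimately show ?thesis by (metis card_image inj_on_subset subset_UNIV)
qed

text \<open>Turns the transform into values of the polynomial with coefficients \<open>g\<close> at
  powers of a root of unity; the negated argument cancels the sign in the transform.\<close>

lemma mod_fourier_eq_poly:
  fixes g :: "'p::prime_card mod_ring \<Rightarrow> complex"
  shows "mod_fourier g (- of_nat b) =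
    (\<Sum>i<CARD('p). g (of_nat i) * (std_char (1 :: 'p mod_ring) ^ b) ^ i)"
proof -
  have "mod_fourier g (- of_nat b) = (\<Sum>x\<in>UNIV. g x * std_char (x * of_nat b))"
    by (simp add: mod_fourier_def)
  also have "\<dots> = (\<Sum>i<CARD('p). g (of_nat i) * std_char (of_nat i * of_nat b :: 'p mod_ring))"
    by (rule sum.reindex_bij_betw[OF bij_of_nat_mod_ring, symmetric])
  also have "\<dots> = (\<Sum>i<CARD('p). g (of_nat i) * (std_char (1 :: 'p mod_ring) ^ b) ^ i)"
    using std_char_of_nat_mult[of b "1 :: 'p mod_ring"] by (simp add: std_char_of_nat_mult)
  finally show ?thesis .
qed

lemma inj_on_std_char_power: "inj_on (\<lambda>b. std_char (1 :: 'p::prime_card mod_ring) ^ b) {..<CARD('p)}"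
proof (rule inj_onI)
  fix a b assume ab: "a \<in> {..<CARD('p)}" "b \<in> {..<CARD('p)}"
    and "std_char (1 :: 'p mod_ring) ^ a = std_char (1 :: 'p mod_ring) ^ b"
  hence "std_char (of_nat a :: 'p mod_ring) = std_char (of_nat b :: 'p mod_ring)"
    by (simp flip: std_char_of_nat_mult)
  hence "(of_nat a :: 'p mod_ring) = of_nat b" using std_char_inj by (metis injD)
  thus "a = b" using ab bij_of_nat_mod_ring[where 'p='p] by (auto simp: bij_betw_def inj_on_def)
qed

lemma bij_betw_Collect_UNIV:
  assumes "bij_betw f S UNIV"
  shows "bij_betw f {x \<in> S. P (f x)} {y. P y}"
proof (rule bij_betw_subset[OF assms])
  show "f ` {x \<in> S. P (f x)} = {y. P y}"
  proof (intro Set.set_eqI iffI)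
    fix y assume y: "y \<in> {y. P y}"
    obtain x where "x \<in> S" "y = f x" using assms by (metis UNIV_I bij_betw_def imageE)
    thus "y \<in> f ` {x \<in> S. P (f x)}" using y by auto
  qed auto
qed auto

lemma card_neg_of_nat:
  "card {b. b < CARD('p) \<and> P (- of_nat b)} = card {y :: 'p::prime_card mod_ring. P y}"
proof (rule bij_betw_same_card)
  have "bij_betw uminus (UNIV :: 'p mod_ring set) UNIV" by (rule bij_uminus)
  from bij_betw_trans[OF bij_of_nat_mod_ring this]
  have "bij_betw (\<lambda>b. - of_nat b) {..<CARD('p)} (UNIV :: 'p mod_ring set)" by (simp add: o_def)
  from bij_betw_Collect_UNIV[OF this, of P]
  show "bij_betw (\<lambda>b. - of_nat b) {b. b < CARD('p) \<and> P (- of_nat b)} {y :: 'p mod_ring. P y}"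
    by simp
qed

lemma card_supp_compl:
  fixes g :: "'g::finite \<Rightarrow> complex"
  shows "card {x. g x = 0} + card (supp g) = CARD('g)"
proof -
  have "card ({x. g x = 0} \<union> supp g) = card {x. g x = 0} + card (supp g)"
    by (intro card_Un_disjoint) (auto simp: supp_eq)
  moreover have "{x. g x = 0} \<union> supp g = UNIV" by (auto simp: supp_eq)
  ultimately show ?thesis by simp
qed

text \<open>Zeros of the transform are roots of the polynomial with coefficients \<open>g\<close>,
  so there are fewer of them than points in \<open>supp g\<close>.\<close>

theorem uncertainty_prime:
  fixes g :: "'p::prime_card mod_ring \<Rightarrow> complex"
  assumes "g \<noteq> (\<lambda>_. 0)"
  shows "CARD('p) < card (supp g) + card (supp (mod_fourier g))"
proof -
  define C where "C = (\<Sum>i<CARD('p). Polynomial.monom (g (of_nat i)) i)"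
  define B where "B = {b. b < CARD('p) \<and> mod_fourier g (- of_nat b) = 0}"
  have coeffC: "coeff C i = (if i < CARD('p) then g (of_nat i) else 0)" for i
    by (simp add: C_def coeff_sum)
  have "card B < card {i. coeff C i \<noteq> 0}"
  proof (rule std_root.card_roots_less_card_coeffs)
    obtain x where "g x \<noteq> 0" using assms by blast
    moreover obtain n where "n < CARD('p)" "x = of_nat n" by (rule of_nat_mod_ring_cases)
    ultimately have "coeff C n \<noteq> 0" by (simp add: coeffC)
    thus "C \<noteq> 0" by auto
    have "degree C \<le> CARD('p) - 1" by (rule degree_le) (auto simp: coeffC)
    moreover have "CARD('p) > 0" by simp
    ultimately show "degree C < CARD('p)" by linarith
    show "finite B" by (simp add: B_def)
    show "inj_on (\<lambda>b. std_char (1 :: 'p mod_ring) ^ b) B"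
      by (rule inj_on_subset[OF inj_on_std_char_power]) (auto simp: B_def)
    show "poly C (std_char (1 :: 'p mod_ring) ^ b) = 0" if "b \<in> B" for b
      using that by (simp add: B_def C_def mod_fourier_eq_poly poly_sum poly_monom)
  qed
  moreover have "card B = card {y. mod_fourier g y = 0}"
    unfolding B_def by (rule card_neg_of_nat)
  moreover have "card {i. coeff C i \<noteq> 0} = card (supp g)"
  proof (rule bij_betw_same_card)
    have "{i. coeff C i \<noteq> 0} = {i \<in> {..<CARD('p)}. g (of_nat i) \<noteq> 0}" by (auto simp: coeffC)
    thus "bij_betw of_nat {i. coeff C i \<noteq> 0} (supp g)"
      unfolding supp_eq using bij_betw_Collect_UNIV[OF bij_of_nat_mod_ring, of "\<lambda>x. g x \<noteq> 0"] by simp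
  qed
  ultimately show ?thesis using card_supp_compl[of "mod_fourier g"] by simp
qed

text \<open>The product \<open>Q\<close> of \<open>k - 1\<close> linear factors has at most
  \<open>k\<close> nonzero coefficients and exactly \<open>k - 1\<close> zeros among the
  \<open>p\<close>-th roots of unity; \<open>uncertainty_prime\<close> then excludes fewer
  coefficients.\<close>

lemma uncertainty_prime_sharp:
  assumes "1 \<le> k" "k \<le> CARD('p::prime_card)"
  obtains g :: "'p::prime_card mod_ring \<Rightarrow> complex"
  where "card (supp g) = k" "card (supp (mod_fourier g)) = CARD('p) + 1 - k"
proof -
  let ?z = "std_char (1 :: 'p mod_ring)"
  define Q where "Q = (\<Prod>b<k - 1. [:- (?z ^ b), 1:])"
  define g :: "'p mod_ring \<Rightarrow> complex" where "g x = coeff Q (nat (to_int_mod_ring x))" for x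
  have to_int: "nat (to_int_mod_ring (of_nat i :: 'p mod_ring)) = i" if "i < CARD('p)" for i
  proof -
    have "to_int_mod_ring (of_nat i :: 'p mod_ring) = int i"
      using that by (metis of_int_of_int_mod_ring of_int_of_nat_eq of_nat_0_le_iff of_nat_less_iff
          to_int_mod_ring_of_int_mod_ring)
    thus ?thesis by simp
  qed
  have degQ: "degree Q = k - 1" by (simp add: Q_def degree_prod_eq_sum_degree)
  have polyQ: "poly Q (?z ^ b) = 0 \<longleftrightarrow> b < k - 1" if "b < CARD('p)" for b
  proof -
    have "poly Q (?z ^ b) = 0 \<longleftrightarrow> (\<exists>a<k - 1. ?z ^ b = ?z ^ a)" by (auto simp: Q_def poly_prod)
    also have "\<dots> \<longleftrightarrow> (\<exists>a<k - 1. b = a)"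
    proof -
      have "?z ^ b = ?z ^ a \<longleftrightarrow> b = a" if "a < k - 1" for a
        using inj_on_std_char_power[where 'p='p] that \<open>b < CARD('p)\<close> assms by (auto simp: inj_on_def)
      thus ?thesis by blast
    qed
    finally show ?thesis by simp
  qed
  have four: "mod_fourier g (- of_nat b) = poly Q (?z ^ b)" for b
  proof -
    have "mod_fourier g (- of_nat b) = (\<Sum>i<CARD('p). coeff Q i * (?z ^ b) ^ i)"
      unfolding mod_fourier_eq_poly g_def using to_int by (intro sum.cong) auto
    also have "\<dots> = (\<Sum>i\<le>degree Q. coeff Q i * (?z ^ b) ^ i)"
      using assms degQ by (intro sum.mono_neutral_right) (auto simp: coeff_eq_0)
    finally show ?thesis by (simp add: poly_altdef)
  qed
  have "card {y. mod_fourier g y = 0} = card {b. b < CARD('p) \<and> mod_fourier g (- of_nat b) = 0}"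
    by (rule card_neg_of_nat[symmetric])
  also have "{b. b < CARD('p) \<and> mod_fourier g (- of_nat b) = 0} = {..<k - 1}"
    using polyQ four assms by auto
  finally have four_card: "card (supp (mod_fourier g)) = CARD('p) + 1 - k"
    using card_supp_compl[of "mod_fourier g"] assms by simp
  have "supp g \<subseteq> of_nat ` {..<k}"
  proof
    fix x assume "x \<in> supp g"
    moreover obtain n where n: "n < CARD('p)" "x = of_nat n" by (rule of_nat_mod_ring_cases)
    ultimately have "coeff Q n \<noteq> 0" by (simp add: supp_eq g_def to_int)
    hence "n \<le> k - 1" using degQ le_degree by metis
    thus "x \<in> of_nat ` {..<k}" using n assms by auto
  qed
  hence "card (supp g) \<le> k" using surj_card_le[of "{..<k}"] by simp
  moreover have "g \<noteq> (\<lambda>_. 0)"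
  proof
    assume "g = (\<lambda>_. 0)"
    hence "mod_fourier g = (\<lambda>_. 0)" by (simp add: mod_fourier_def fun_eq_iff)
    hence "card (supp (mod_fourier g)) = 0" by (simp add: supp_eq)
    with four_card assms show False by simp
  qed
  from uncertainty_prime[OF this] have "k \<le> card (supp g)" using four_card assms by simp
  ultimately show ?thesis using four_card that by simp
qed

section \<open>The Fourier transform on the plane\<close>

definition dot :: "'p::prime_card plane \<Rightarrow> 'p plane \<Rightarrow> 'p mod_ring"
  where "dot x y = x $ 1 * y $ 1 + x $ 2 * y $ 2"

lemma dot_simps:
  "dot (x + y) w = dot x w + dot y w" "dot w (x + y) = dot w x + dot w y"
  "dot (- x) w = - dot x w" "dot (x - y) w = dot x w - dot y w" "dot 0 w = 0"
  "dot (c *s x) w = c * dot x w"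
  by (simp_all add: dot_def algebra_simps)

lemma dot_commute: "dot x y = dot y x"
  by (simp add: dot_def mult.commute)

lemma plane_char_eq: "plane_char y x = std_char (dot x y)"
  by (simp add: plane_char_def std_char_def dot_def)

lemma plane_fourier_eq: "plane_fourier f y = (\<Sum>x\<in>UNIV. f x * std_char (- dot x y))"
  by (simp add: plane_fourier_def fourier_def plane_char_eq dot_simps)

lemma plane_eq_iff: "x = y \<longleftrightarrow> x $ 1 = y $ 1 \<and> x $ 2 = (y :: 'a ^ 2) $ 2"
  by (simp add: Finite_Cartesian_Product.vec_eq_iff forall_2)

lemma vector_plane: "vector [x $ 1, x $ 2] = (x :: 'a::zero ^ 2)"
  by (simp add: plane_eq_iff)

lemma sum_plane: "(\<Sum>x\<in>UNIV. f x) = (\<Sum>a\<in>UNIV. \<Sum>b\<in>UNIV. f (vector [a, b] :: 'a::{finite,zero} ^ 2))"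
proof -
  have "(\<Sum>x\<in>UNIV. f x) = (\<Sum>(a, b)\<in>UNIV \<times> UNIV. f (vector [a, b] :: 'a ^ 2))"
    by (rule sum.reindex_bij_witness[of _ "\<lambda>(a, b). vector [a, b]" "\<lambda>x. (x $ 1, x $ 2)"])
      (auto simp: vector_plane)
  thus ?thesis by (simp add: sum.cartesian_product)
qed

lemma card_plane_sections:
  "card {x :: 'a::{finite,zero} ^ 2. P x} = (\<Sum>b\<in>UNIV. card {a. P (vector [a, b])})"
proof -
  have "card {x :: 'a ^ 2. P x} = (\<Sum>x\<in>UNIV. if P x then 1 else 0)" by (simp add: sum.If_cases)
  also have "\<dots> = (\<Sum>b\<in>UNIV. \<Sum>a\<in>UNIV. if P (vector [a, b]) then 1 else 0)"
    by (subst sum_plane) (rule sum.swap)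
  finally show ?thesis by (simp add: sum.If_cases)
qed

text \<open>The restrictions to the two axes are characters of Z_p, and a character is the product
  of its restrictions.\<close>

lemma characters_plane: "(characters :: ('p::prime_card plane \<Rightarrow> complex) set) = range plane_char"
proof
  show "range plane_char \<subseteq> (characters :: ('p plane \<Rightarrow> complex) set)"
    by (auto simp: characters_def plane_char_eq norm_std_char dot_simps std_char_add)
  show "(characters :: ('p plane \<Rightarrow> complex) set) \<subseteq> range plane_char"
  proof
    fix \<psi> :: "'p plane \<Rightarrow> complex" assume \<psi>: "\<psi> \<in> characters"
    have vadd: "vector [a + b, 0] = (vector [a, 0] + vector [b, 0] :: 'p plane)"
      "vector [0, a + b] = (vector [0, a] + vector [0, b] :: 'p plane)" for a b
      by (simp_all add: plane_eq_iff)
    have "(\<lambda>a. \<psi> (vector [a, 0])) \<in> characters" "(\<lambda>b. \<psi> (vector [0, b])) \<in> characters"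
      using \<psi> by (simp_all add: characters_def vadd)
    then obtain c d where cd: "(\<lambda>a. \<psi> (vector [a, 0])) = (\<lambda>x. std_char (x * c))"
        "(\<lambda>b. \<psi> (vector [0, b])) = (\<lambda>x. std_char (x * d))"
      unfolding characters_mod_ring by blast
    have "\<psi> x = plane_char (vector [c, d]) x" for x
    proof -
      have "x = vector [x $ 1, 0] + vector [0, x $ 2]" by (simp add: plane_eq_iff)
      hence "\<psi> x = \<psi> (vector [x $ 1, 0]) * \<psi> (vector [0, x $ 2])"
        using \<psi> by (metis (mono_tags, lifting) characters_def mem_Collect_eq)
      thus ?thesis using cd by (simp add: fun_eq_iff plane_char_eq dot_def std_char_add)
    qed
    thus "\<psi> \<in> range plane_char" by blast
  qed
qed

lemma card_fourier_supp_plane: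
  fixes f :: "'p::prime_card plane \<Rightarrow> complex"
  shows "card (fourier_supp f) = card (supp (plane_fourier f))"
proof -
  have "inj (plane_char :: 'p plane \<Rightarrow> _)"
  proof (rule injI)
    fix x y :: "'p plane" assume "plane_char x = plane_char y"
    hence "std_char (dot w x) = std_char (dot w y)" for w by (metis plane_char_eq)
    hence "dot w x = dot w y" for w by (metis injD std_char_inj)
    from this[of "vector [1, 0]"] this[of "vector [0, 1]"]
    show "x = y" by (simp add: dot_def plane_eq_iff)
  qed
  moreover have "fourier_supp f = plane_char ` supp (plane_fourier f)"
    by (auto simp: support_on_def characters_plane plane_fourier_def)
  ultimately show ?thesis by (metis card_image inj_on_subset subset_UNIV)
qed

lemma equality_case_plane:
  "equality_case k (f :: 'p::prime_card plane \<Rightarrow> complex) \<longleftrightarrow>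
    card (supp f) = k \<and> enat (card (supp (plane_fourier f))) = theta k TYPE('p plane)"
  by (simp add: equality_case_def card_fourier_supp_plane)

lemma card_supp_comp_bij:
  assumes "bij h"
  shows "card (supp (\<lambda>x. f (h x))) = card (supp f)"
proof (rule bij_betw_same_card)
  show "bij_betw h (supp (\<lambda>x. f (h x))) (supp f)"
    using bij_betw_Collect_UNIV[OF assms, of "\<lambda>x. f x \<noteq> 0"] by (simp add: supp_eq)
qed

lemma sum_std_char_dot:
  "(\<Sum>y\<in>UNIV. std_char (dot c (y :: 'p::prime_card plane))) = (if c = 0 then of_nat CARD('p) ^ 2 else 0)"
proof -
  have "(\<Sum>y\<in>UNIV. std_char (dot c (y :: 'p plane))) =
      (\<Sum>a\<in>UNIV. std_char (c $ 1 * a)) * (\<Sum>b\<in>UNIV. std_char (c $ 2 * b))"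
    by (subst sum_plane) (simp add: dot_def std_char_add sum_product)
  thus ?thesis by (auto simp: sum_std_char plane_eq_iff power2_eq_square)
qed

text \<open>Fourier inversion, from orthogonality of characters. It makes the transform interchange
  the two support sizes, which links small and large \<open>k\<close>.\<close>

lemma plane_fourier_twice:
  fixes f :: "'p::prime_card plane \<Rightarrow> complex"
  shows "plane_fourier (plane_fourier f) x = of_nat CARD('p) ^ 2 * f (- x)"
proof -
  have "plane_fourier (plane_fourier f) x =
      (\<Sum>y\<in>UNIV. \<Sum>w\<in>UNIV. f w * std_char (dot (- x - w) y))"
    by (simp add: plane_fourier_eq sum_distrib_right mult.assoc dot_simps dot_commute[of _ x]
        minus_diff_commute flip: std_char_add)
  also have "\<dots> = (\<Sum>w\<in>UNIV. f w * (\<Sum>y\<in>UNIV. std_char (dot (- x - w) y)))"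
    by (subst sum.swap) (simp add: sum_distrib_left)
  also have "\<dots> = (\<Sum>w\<in>UNIV. if w = - x then of_nat CARD('p) ^ 2 * f w else 0)"
    by (intro sum.cong) (auto simp: sum_std_char_dot)
  finally show ?thesis by simp
qed

lemma card_supp_plane_fourier_twice:
  fixes f :: "'p::prime_card plane \<Rightarrow> complex"
  shows "card (supp (plane_fourier (plane_fourier f))) = card (supp f)"
proof -
  have "card (supp (plane_fourier (plane_fourier f))) = card (supp (\<lambda>x. f (- x)))"
    by (simp add: supp_eq plane_fourier_twice)
  thus ?thesis by (simp add: card_supp_comp_bij[OF bij_uminus])
qed

lemma surj_plane_fourier: "\<exists>f. plane_fourier f = (g :: 'p::prime_card plane \<Rightarrow> complex)"
proof
  define c where "c = complex_of_nat CARD('p) ^ 2"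
  have scale: "plane_fourier (\<lambda>x. h x / c) y = plane_fourier h y / c" for h and y :: "'p plane"
    by (simp add: plane_fourier_eq sum_divide_distrib)
  have refl: "plane_fourier (\<lambda>x. h (- x)) y = plane_fourier h (- y)" for h and y :: "'p plane"
    unfolding plane_fourier_eq
    by (rule sum.reindex_bij_witness[of _ uminus uminus]) (simp_all add: dot_def)
  show "plane_fourier (\<lambda>x. plane_fourier g (- x) / c) = g"
    unfolding scale refl by (auto simp: plane_fourier_twice c_def fun_eq_iff)
qed

lemma plane_fourier_eq_0_iff:
  fixes f :: "'p::prime_card plane \<Rightarrow> complex"
  shows "plane_fourier f = (\<lambda>_. 0) \<longleftrightarrow> f = (\<lambda>_. 0)"
proof
  assume "plane_fourier f = (\<lambda>_. 0)"
  hence "plane_fourier (plane_fourier f) = (\<lambda>_. 0)" by (simp add: plane_fourier_eq fun_eq_iff)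
  hence "of_nat CARD('p) ^ 2 * f (- x) = 0" for x by (metis plane_fourier_twice)
  hence "f (- x) = 0" for x by simp
  from this[of "- _"] show "f = (\<lambda>_. 0)" by auto
qed (simp add: plane_fourier_eq fun_eq_iff)

lemma card_supp_eq_0_iff: "card (supp (f :: 'g::finite \<Rightarrow> complex)) = 0 \<longleftrightarrow> f = (\<lambda>_. 0)"
  by (auto simp: supp_eq)

section \<open>Changes of coordinates\<close>

text \<open>The linear map with columns \<open>m\<close> and \<open>n\<close>; it carries horizontal
  lines to cosets of \<open>line m\<close>. The recurring expression
  \<open>m $ 1 * n $ 2 - m $ 2 * n $ 1\<close> is its determinant.\<close>

definition lin :: "'p::prime_card plane \<Rightarrow> 'p plane \<Rightarrow> 'p plane \<Rightarrow> 'p plane"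
  where "lin m n x = x $ 1 *s m + x $ 2 *s n"

lemma lin_simps:
  "lin m n (x + y) = lin m n x + lin m n y" "lin m n (x - y) = lin m n x - lin m n y"
  by (simp_all add: lin_def plane_eq_iff algebra_simps)

lemma bij_lin:
  fixes m n :: "'p::prime_card plane"
  assumes "m $ 1 * n $ 2 - m $ 2 * n $ 1 \<noteq> 0"
  shows "bij (lin m n)"
proof -
  let ?d = "m $ 1 * n $ 2 - m $ 2 * n $ 1"
  have "x = 0" if x: "lin m n x = 0" for x
  proof -
    have eqs: "x $ 1 * m $ 1 + x $ 2 * n $ 1 = 0" "x $ 1 * m $ 2 + x $ 2 * n $ 2 = 0"
      using x by (simp_all add: lin_def plane_eq_iff)
    \<comment> \<open>Cramer's rule, cleared of denominators.\<close>
    have "x $ 1 * ?d = (x $ 1 * m $ 1 + x $ 2 * n $ 1) * n $ 2 - (x $ 1 * m $ 2 + x $ 2 * n $ 2) * n $ 1"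
      by (simp add: algebra_simps)
    moreover have "x $ 2 * ?d = (x $ 1 * m $ 2 + x $ 2 * n $ 2) * m $ 1 - (x $ 1 * m $ 1 + x $ 2 * n $ 1) * m $ 2"
      by (simp add: algebra_simps)
    ultimately show ?thesis using assms unfolding eqs by (simp add: plane_eq_iff)
  qed
  hence "inj (lin m n)" by (intro injI) (metis lin_simps(2) right_minus_eq)
  thus ?thesis by (simp add: bij_def finite_UNIV_inj_surj)
qed

lemma exists_complement:
  fixes m :: "'p::prime_card plane"
  assumes "m \<noteq> 0"
  obtains n :: "'p::prime_card plane" where "m $ 1 * n $ 2 - m $ 2 * n $ 1 \<noteq> 0"
proof (cases "m $ 1 = 0")
  case True
  hence "m $ 2 \<noteq> 0" using assms by (simp add: plane_eq_iff)
  with True show ?thesis using that[of "vector [1, 0]"] by simp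
next
  case False
  show ?thesis by (rule that[of "vector [0, 1]"]) (use False in simp)
qed

text \<open>The change of variables moves to the frequency side as the transposed map
  \<open>h\<close>, which has the same determinant and is therefore a bijection between the
  supports.\<close>

lemma card_supp_plane_fourier_lin:
  fixes f :: "'p::prime_card plane \<Rightarrow> complex"
  assumes det: "m $ 1 * n $ 2 - m $ 2 * n $ 1 \<noteq> 0"
  shows "card (supp (plane_fourier (\<lambda>x. f (lin m n x)))) = card (supp (plane_fourier f))"
proof -
  define h where "h = lin (vector [m $ 1, n $ 1]) (vector [m $ 2, n $ 2] :: 'p plane)"
  have bij: "bij h" unfolding h_def by (rule bij_lin) (use det in \<open>simp add: mult.commute\<close>)
  have h: "dot x (h y) = dot (lin m n x) y" for x y
    by (simp add: dot_def h_def lin_def algebra_simps)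
  have "plane_fourier (\<lambda>x. f (lin m n x)) (h y) = plane_fourier f y" for y
    unfolding plane_fourier_eq h
    by (rule sum.reindex_bij_betw[OF bij_lin[OF det], of "\<lambda>x. f x * std_char (- dot x y)"])
  hence "card (supp (\<lambda>y. plane_fourier (\<lambda>x. f (lin m n x)) (h y))) = card (supp (plane_fourier f))"
    by simp
  thus ?thesis by (simp add: card_supp_comp_bij[OF bij])
qed

lemma card_supp_translate: "card (supp (translate c f)) = card (supp f)"
  unfolding translate_def by (rule card_supp_comp_bij) (rule bij_diff_right)

lemma plane_fourier_translate: "plane_fourier (translate c f) y = std_char (- dot c y) * plane_fourier f y"
proof -
  have "plane_fourier (translate c f) y = (\<Sum>x\<in>UNIV. f x * std_char (- dot (x + c) y))"
    unfolding plane_fourier_eq translate_def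
    by (rule sum.reindex_bij_witness[of _ "\<lambda>x. x + c" "\<lambda>x. x - c"]) auto
  also have "\<dots> = std_char (- dot c y) * plane_fourier f y"
    by (simp add: plane_fourier_eq dot_simps sum_distrib_left mult.left_commute minus_diff_commute
        flip: std_char_add)
  finally show ?thesis .
qed

lemma card_supp_plane_fourier_translate:
  "card (supp (plane_fourier (translate c f))) = card (supp (plane_fourier f))"
  by (simp add: supp_eq plane_fourier_translate std_char_nonzero)

lemma card_supp_tensor_delta:
  "card (supp (g \<otimes>\<^sub>f translate a delta)) = card (supp g)"
proof (rule bij_betw_same_card[symmetric])
  show "bij_betw (\<lambda>s. vector [s, a]) (supp g) (supp (g \<otimes>\<^sub>f translate a delta))"
    by (rule bij_betw_byWitness[where f' = "\<lambda>x. x $ 1"])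
      (auto simp: supp_eq tensor_def translate_def delta_def indicator_def plane_eq_iff split: if_splits)
qed

text \<open>The transform of a point mass vanishes nowhere, so each point of
  \<open>supp (mod_fourier g)\<close> contributes a full line of \<open>p\<close> points.\<close>

lemma card_supp_plane_fourier_tensor_delta:
  fixes g :: "'p::prime_card mod_ring \<Rightarrow> complex"
  shows "card (supp (plane_fourier (g \<otimes>\<^sub>f translate a delta))) = CARD('p) * card (supp (mod_fourier g))"
proof -
  have "plane_fourier (g \<otimes>\<^sub>f translate a delta) y = mod_fourier g (y $ 1) * std_char (- (a * y $ 2))" for y
  proof -
    have "plane_fourier (g \<otimes>\<^sub>f translate a delta) y =
        (\<Sum>s\<in>UNIV. \<Sum>t\<in>UNIV. if t = a then g s * std_char (- (s * y $ 1)) * std_char (- (t * y $ 2)) else 0)"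
      unfolding plane_fourier_eq
      by (subst sum_plane, intro sum.cong refl)
        (auto simp: tensor_def translate_def delta_def indicator_def dot_def simp flip: std_char_add)
    thus ?thesis by (simp add: mod_fourier_def sum_distrib_right)
  qed
  hence "supp (plane_fourier (g \<otimes>\<^sub>f translate a delta)) = {y. mod_fourier g (y $ 1) \<noteq> 0}"
    by (simp add: supp_eq std_char_nonzero)
  thus ?thesis by (simp add: card_plane_sections supp_eq)
qed

section \<open>Bounds for the support of the transform\<close>

text \<open>The transform is taken first along the rows and then across them, with
  \<open>uncertainty_prime\<close> applied at each stage.\<close>

lemma meshulam_product_bound:
  fixes f :: "'p::prime_card plane \<Rightarrow> complex"
  defines "sec \<equiv> \<lambda>b. {a. f (vector [a, b]) \<noteq> 0}"
  defines "t \<equiv> card {b. sec b \<noteq> {}}"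
  assumes "f \<noteq> (\<lambda>_. 0)"
  obtains s where "1 \<le> s" "s \<le> CARD('p)" "s * t \<le> card (supp f)"
    "(CARD('p) + 1 - s) * (CARD('p) + 1 - t) \<le> card (supp (plane_fourier f))"
proof -
  define T where "T = {b. sec b \<noteq> {}}"
  define s where "s = Min ((\<lambda>b. card (sec b)) ` T)"
  obtain x where "f x \<noteq> 0" using assms by blast
  hence "x $ 1 \<in> sec (x $ 2)" by (simp add: sec_def vector_plane)
  hence T: "T \<noteq> {}" "finite T" by (auto simp: T_def)
  hence "s \<in> (\<lambda>b. card (sec b)) ` T" unfolding s_def by (intro Min_in) auto
  then obtain c where c: "c \<in> T" "s = card (sec c)" by blast
  have s: "s \<le> card (sec b)" if "b \<in> T" for b
    unfolding s_def using that T by (intro Min_le) auto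
  have "1 \<le> s" using c by (simp add: T_def Suc_le_eq card_gt_0_iff)
  moreover have "s \<le> CARD('p)" using card_mono[of UNIV "sec c"] c by simp
  moreover have "s * t \<le> card (supp f)"
  proof -
    have "s * t = (\<Sum>b\<in>T. s)" by (simp add: t_def T_def)
    also have "\<dots> \<le> (\<Sum>b\<in>T. card (sec b))" using s by (intro sum_mono)
    also have "\<dots> \<le> (\<Sum>b\<in>UNIV. card (sec b))" by (intro sum_mono2) auto
    also have "\<dots> = card (supp f)" by (simp add: supp_eq card_plane_sections sec_def)
    finally show ?thesis .
  qed
  moreover have "(CARD('p) + 1 - s) * (CARD('p) + 1 - t) \<le> card (supp (plane_fourier f))"
  proof -
    define G where "G y b = mod_fourier (\<lambda>a. f (vector [a, b])) y" for y b
    \<comment> \<open>Frequencies at which the smallest row \<open>c\<close> has nonzero transform;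
      for these, \<open>G y\<close> is nonzero and supported in the \<open>t\<close> nonempty
      rows.\<close>
    define Y where "Y = supp (\<lambda>y. G y c)"
    have FG: "plane_fourier f (vector [y, w]) = mod_fourier (G y) w" for y w
    proof -
      have "plane_fourier f (vector [y, w]) =
          (\<Sum>b\<in>UNIV. \<Sum>a\<in>UNIV. f (vector [a, b]) * std_char (- (a * y)) * std_char (- (b * w)))"
        unfolding plane_fourier_eq
        by (subst sum_plane, subst sum.swap)
          (simp add: dot_def mult.assoc minus_diff_commute flip: std_char_add)
      thus ?thesis by (simp add: mod_fourier_def G_def sum_distrib_right)
    qed
    have "(\<lambda>a. f (vector [a, c])) \<noteq> (\<lambda>_. 0)" using c by (auto simp: T_def sec_def fun_eq_iff)
    from uncertainty_prime[OF this] have Y: "CARD('p) + 1 - s \<le> card Y"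
      using c by (simp add: Y_def G_def supp_eq sec_def)
    have row_bound: "CARD('p) + 1 - t \<le> card (supp (mod_fourier (G y)))" if "y \<in> Y" for y
    proof -
      have "G y c \<noteq> 0" using that by (simp add: Y_def supp_eq)
      hence "G y \<noteq> (\<lambda>_. 0)" by auto
      from uncertainty_prime[OF this] 
      have "CARD('p) < card (supp (G y)) + card (supp (mod_fourier (G y)))" .
      moreover have "G y b = 0" if "b \<notin> T" for b
        using that by (simp add: G_def mod_fourier_def T_def sec_def)
      hence "supp (G y) \<subseteq> T" by (auto simp: supp_eq)
      hence "card (supp (G y)) \<le> t" unfolding t_def T_def[symmetric] using T by (intro card_mono)
      ultimately show ?thesis by linarith
    qed
    have "(CARD('p) + 1 - s) * (CARD('p) + 1 - t) \<le> card Y * (CARD('p) + 1 - t)"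
      using Y by (rule mult_le_mono1)
    also have "\<dots> = (\<Sum>y\<in>Y. CARD('p) + 1 - t)" by simp
    also have "\<dots> \<le> (\<Sum>y\<in>Y. card (supp (mod_fourier (G y))))"
      using row_bound by (rule sum_mono)
    also have "\<dots> \<le> (\<Sum>y\<in>UNIV. card (supp (mod_fourier (G y))))" by (intro sum_mono2) auto
    also have "\<dots> = card (supp (plane_fourier f))"
    proof -
      have "card (supp (plane_fourier f)) = (\<Sum>w\<in>UNIV. \<Sum>y\<in>UNIV. if plane_fourier f (vector [y, w]) \<noteq> 0 then 1 else 0)"
        by (simp add: supp_eq card_plane_sections sum.If_cases)
      also have "\<dots> = (\<Sum>y\<in>UNIV. \<Sum>w\<in>UNIV. if plane_fourier f (vector [y, w]) \<noteq> 0 then 1 else 0)"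
        by (rule sum.swap)
      finally show ?thesis by (simp add: FG supp_eq sum.If_cases)
    qed
    finally show ?thesis .
  qed
  ultimately show ?thesis by (rule that)
qed

section \<open>Collinear and noncollinear supports\<close>

definition collinear_supp :: "('p::prime_card plane \<Rightarrow> complex) \<Rightarrow> bool"
  where "collinear_supp f \<longleftrightarrow> (\<exists>c m. m \<noteq> 0 \<and> (\<forall>x\<in>supp f. x - c \<in> line m))"

lemma line_iff:
  fixes m n :: "'p::prime_card plane"
  assumes "m $ 1 * n $ 2 - m $ 2 * n $ 1 \<noteq> 0"
  shows "lin m n x \<in> line m \<longleftrightarrow> x $ 2 = 0"
proof
  assume "lin m n x \<in> line m"
  then obtain j where "lin m n x = j *s m" by (auto simp: line_def)
  hence "lin m n x = lin m n (vector [j, 0])" by (simp add: lin_def)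
  hence "x = vector [j, 0]" using bij_lin[OF assms] by (metis bij_def injD)
  thus "x $ 2 = 0" by simp
qed (auto simp: lin_def line_def)

lemma tensor_delta_of_section:
  fixes f :: "'p::prime_card plane \<Rightarrow> complex"
  assumes "\<And>x. f x \<noteq> 0 \<Longrightarrow> x $ 2 = a"
  shows "f = (\<lambda>s. f (vector [s, a])) \<otimes>\<^sub>f translate a delta"
proof
  fix x :: "'p plane"
  have "vector [x $ 1, a] = x" if "x $ 2 = a" using that vector_plane[of x] by simp
  thus "f x = ((\<lambda>s. f (vector [s, a])) \<otimes>\<^sub>f translate a delta) x"
    using assms[of x] by (auto simp: tensor_def translate_def delta_def indicator_def)
qed

text \<open>A translation and a change of basis, which preserve both support sizes, move the support
  into the first axis, where \<open>f\<close> becomes \<open>g\<close> tensored with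
  \<open>delta\<close>.\<close>

lemma collinear_supp_card:
  fixes f :: "'p::prime_card plane \<Rightarrow> complex"
  assumes "collinear_supp f"
  obtains g :: "'p mod_ring \<Rightarrow> complex" where "card (supp f) = card (supp g)"
    "card (supp (plane_fourier f)) = CARD('p) * card (supp (mod_fourier g))"
proof -
  obtain c m where cm: "m \<noteq> 0" "\<And>x. f x \<noteq> 0 \<Longrightarrow> x - c \<in> line m"
    using assms by (auto simp: collinear_supp_def supp_eq)
  obtain n :: "'p plane" where det: "m $ 1 * n $ 2 - m $ 2 * n $ 1 \<noteq> 0" using exists_complement[OF cm(1)] .
  define h where "h x = translate (- c) f (lin m n x)" for x :: "'p plane"
  define g where "g s = h (vector [s, 0])" for s
  have "x $ 2 = 0" if "h x \<noteq> 0" for x :: "'p plane"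
    using cm(2)[of "lin m n x + c"] that by (simp add: h_def translate_def line_iff[OF det])
  hence h: "h = g \<otimes>\<^sub>f translate 0 delta" unfolding g_def by (rule tensor_delta_of_section)
  have "card (supp f) = card (supp h)"
    unfolding h_def card_supp_comp_bij[OF bij_lin[OF det]] card_supp_translate ..
  moreover have "card (supp (plane_fourier f)) = card (supp (plane_fourier h))"
    unfolding h_def card_supp_plane_fourier_lin[OF det] card_supp_plane_fourier_translate ..
  ultimately show ?thesis
    using that[of g] unfolding h card_supp_tensor_delta card_supp_plane_fourier_tensor_delta by simp
qed

lemma product_bound_arith:
  fixes s t k p :: nat
  assumes "1 \<le> s" "s \<le> p" "2 \<le> t" "t < k" "s * t \<le> k" "k \<le> p"
  shows "p * (p + 2 - k) \<le> (p + 1 - s) * (p + 1 - t)"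
proof -
  \<comment> \<open>In these terms the product is \<open>(p - u) * (p - v)\<close>, which exceeds
    \<open>p * (p - (u + v))\<close> by \<open>u * v\<close>; it remains to see that
    \<open>u + v + 2 \<le> k\<close>.\<close>
  define u v where "u = s - 1" and "v = t - 1"
  have uv: "s = u + 1" "t = v + 1" "v \<ge> 1" using assms by (auto simp: u_def v_def)
  have "u + v + 2 \<le> k"
  proof (cases "u = 0")
    case False
    hence "u * v \<ge> 1" using uv by simp
    moreover have "s * t = u * v + u + v + 1" by (simp add: uv algebra_simps)
    ultimately show ?thesis using assms(5) by linarith
  qed (use assms uv in linarith)
  hence "p + 2 - k \<le> p - (u + v)" by simp
  hence "p * (p + 2 - k) \<le> p * (p - (u + v))" by (rule mult_le_mono2)
  also have "\<dots> \<le> (p - u) * (p - v)"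
  proof -
    have "u + v \<le> p" using \<open>u + v + 2 \<le> k\<close> assms by linarith
    hence "int (p * (p - (u + v))) \<le> int ((p - u) * (p - v))"
      by (simp add: of_nat_diff algebra_simps)
    thus ?thesis by (simp only: of_nat_le_iff)
  qed
  finally show ?thesis by (simp add: uv)
qed

text \<open>Counting along the direction of two points of the support makes the number of nonempty
  cosets smaller than the number of points.\<close>
lemma noncollinear_bound:
  fixes f :: "'p::prime_card plane \<Rightarrow> complex"
  assumes nc: "\<not> collinear_supp f" and k: "card (supp f) \<le> CARD('p)"
  shows "CARD('p) * (CARD('p) + 2 - card (supp f)) \<le> card (supp (plane_fourier f))"
proof -
  have "\<exists>m :: 'p plane. m \<noteq> 0" by (rule exI[of _ "vector [1, 0]"]) (simp add: plane_eq_iff)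
  then obtain m0 :: "'p plane" where m0: "m0 \<noteq> 0" ..
  have zero_line: "0 \<in> line m" for m :: "'p plane" by (simp add: line_def image_iff exI[of _ 0])
  obtain u where u: "f u \<noteq> 0" using nc m0 by (auto simp: collinear_supp_def supp_eq)
  \<comment> \<open>A single support point would be collinear with any direction, here
    \<open>m0\<close>.\<close>
  obtain v where v: "f v \<noteq> 0" "v \<noteq> u"
  proof -
    have "\<not> (\<forall>x\<in>supp f. x - u \<in> line m0)" using nc m0 unfolding collinear_supp_def by blast
    then obtain x where "f x \<noteq> 0" "x - u \<notin> line m0" by (auto simp: supp_eq)
    thus ?thesis using that[of x] zero_line[of m0] by (metis diff_self)
  qed
  define m where "m = v - u"
  have m: "m \<noteq> 0" using v by (simp add: m_def)
  obtain n :: "'p plane" where det: "m $ 1 * n $ 2 - m $ 2 * n $ 1 \<noteq> 0" using exists_complement[OF m] .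
  \<comment> \<open>A third point off the line through \<open>u\<close> and \<open>v\<close>
    guarantees a second nonempty row.\<close>
  have "\<not> (\<forall>x\<in>supp f. x - u \<in> line m)" using nc m unfolding collinear_supp_def by blast
  then obtain w where w: "f w \<noteq> 0" "w - u \<notin> line m" by (auto simp: supp_eq)
  define h where "h x = f (lin m n x)" for x :: "'p plane"
  have bij: "bij (lin m n)" by (rule bij_lin[OF det])
  obtain x y z where xyz: "u = lin m n x" "v = lin m n y" "w = lin m n z"
    using bij by (metis bij_pointE)
  have supp_h: "card (supp h) = card (supp f)" unfolding h_def by (rule card_supp_comp_bij[OF bij])
  have same_row: "x $ 2 = y $ 2"
  proof -
    have "lin m n (y - x) \<in> line m"
      unfolding lin_simps xyz[symmetric] m_def[symmetric] by (auto simp: line_def image_iff intro: exI[of _ 1])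
    thus ?thesis using line_iff[OF det, of "y - x"] by simp
  qed
  have other_row: "x $ 2 \<noteq> z $ 2"
    using w(2) line_iff[OF det, of "z - x"] unfolding lin_simps xyz[symmetric] by auto
  define T where "T = {b. {a. h (vector [a, b]) \<noteq> 0} \<noteq> {}}"
  have hT: "b $ 2 \<in> T" if "h b \<noteq> 0" for b :: "'p plane"
    using that by (auto simp: T_def vector_plane intro!: exI[of _ "b $ 1"])
  have nz: "h x \<noteq> 0" "h y \<noteq> 0" "h z \<noteq> 0" using u v w by (simp_all add: h_def flip: xyz)
  have "card {x $ 2, z $ 2} \<le> card T" using hT nz by (intro card_mono) auto
  hence t2: "2 \<le> card T" using other_row by simp
  have tk: "card T < card (supp f)"
  proof -
    \<comment> \<open>Removing \<open>x\<close> loses no row, because \<open>y\<close> lies in the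
      same one.\<close>
    have "T \<subseteq> (\<lambda>x. x $ 2) ` (supp h - {x})"
    proof
      fix b assume "b \<in> T"
      then obtain a where a: "h (vector [a, b]) \<noteq> 0" by (auto simp: T_def)
      show "b \<in> (\<lambda>x. x $ 2) ` (supp h - {x})"
      proof (cases "vector [a, b] = x")
        case True
        hence "b = y $ 2" using same_row by auto
        moreover have "y \<noteq> x" using v(2) xyz by auto
        ultimately show ?thesis using nz by (auto simp: supp_eq)
      next
        case False
        thus ?thesis using a by (intro image_eqI[of _ _ "vector [a, b]"]) (auto simp: supp_eq)
      qed
    qed
    hence "card T \<le> card (supp h - {x})" by (intro surj_card_le) auto
    also have "\<dots> < card (supp h)" using nz by (intro card_Diff1_less) (auto simp: supp_eq)
    finally show ?thesis by (simp add: supp_h)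
  qed
  have "h \<noteq> (\<lambda>_. 0)" using nz by auto
  from meshulam_product_bound[OF this] obtain s where s: "1 \<le> s" "s \<le> CARD('p)"
      "s * card T \<le> card (supp h)"
      "(CARD('p) + 1 - s) * (CARD('p) + 1 - card T) \<le> card (supp (plane_fourier h))"
    unfolding T_def by metis
  have "CARD('p) * (CARD('p) + 2 - card (supp f)) \<le> (CARD('p) + 1 - s) * (CARD('p) + 1 - card T)"
    using s t2 tk k by (intro product_bound_arith) (simp_all add: supp_h)
  also have "\<dots> \<le> card (supp (plane_fourier h))" by (rule s(4))
  also have "\<dots> = card (supp (plane_fourier f))"
    unfolding h_def by (rule card_supp_plane_fourier_lin[OF det])
  finally show ?thesis .
qed

text \<open>The divisibility, applied to the transform of an equality case, is what yields
  \<open>p dvd k\<close> for large \<open>k\<close>.\<close>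

lemma collinear_bound:
  fixes f :: "'p::prime_card plane \<Rightarrow> complex"
  assumes "collinear_supp f" "f \<noteq> (\<lambda>_. 0)"
  shows "CARD('p) * (CARD('p) + 1 - card (supp f)) \<le> card (supp (plane_fourier f))"
    and "CARD('p) dvd card (supp (plane_fourier f))"
proof -
  obtain g :: "'p mod_ring \<Rightarrow> complex" where g: "card (supp f) = card (supp g)"
    "card (supp (plane_fourier f)) = CARD('p) * card (supp (mod_fourier g))"
    by (rule collinear_supp_card[OF assms(1)])
  have "g \<noteq> (\<lambda>_. 0)" using assms(2) g(1) by (metis card_supp_eq_0_iff)
  from uncertainty_prime[OF this] show "CARD('p) * (CARD('p) + 1 - card (supp f)) \<le> card (supp (plane_fourier f))"
    unfolding g by (intro mult_le_mono2) linarith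
  show "CARD('p) dvd card (supp (plane_fourier f))" by (simp add: g)
qed

section \<open>Meshulam's function and its equality cases\<close>

lemma theta_le:
  fixes f :: "'p::prime_card plane \<Rightarrow> complex"
  assumes "f \<noteq> (\<lambda>_. 0)" "card (supp f) \<le> k"
  shows "theta k TYPE('p plane) \<le> enat (card (supp (plane_fourier f)))"
  unfolding theta_def using assms by (intro Inf_lower) (auto simp: card_fourier_supp_plane)

lemma theta_ge:
  assumes "\<And>f :: 'p::prime_card plane \<Rightarrow> complex. f \<noteq> (\<lambda>_. 0) \<Longrightarrow> card (supp f) \<le> k \<Longrightarrow>
    n \<le> card (supp (plane_fourier f))"
  shows "enat n \<le> theta k TYPE('p plane)"
  unfolding theta_def using assms by (intro Inf_greatest) (auto simp: card_fourier_supp_plane)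

lemma small_supp_bound:
  fixes f :: "'p::prime_card plane \<Rightarrow> complex"
  assumes "f \<noteq> (\<lambda>_. 0)" "card (supp f) \<le> CARD('p)"
  shows "CARD('p) * (CARD('p) + 1 - card (supp f)) \<le> card (supp (plane_fourier f))"
proof (cases "collinear_supp f")
  case False
  have "CARD('p) * (CARD('p) + 1 - card (supp f)) \<le> CARD('p) * (CARD('p) + 2 - card (supp f))"
    by (intro mult_le_mono2) simp
  thus ?thesis using noncollinear_bound[OF False assms(2)] by (rule le_trans)
qed (use collinear_bound assms in blast)

lemma small_supp_sharp:
  assumes "1 \<le> k" "k \<le> CARD('p::prime_card)"
  obtains f :: "'p::prime_card plane \<Rightarrow> complex"
  where "card (supp f) = k" "card (supp (plane_fourier f)) = CARD('p) * (CARD('p) + 1 - k)"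
proof -
  obtain g :: "'p mod_ring \<Rightarrow> complex" where
    "card (supp g) = k" "card (supp (mod_fourier g)) = CARD('p) + 1 - k"
    by (rule uncertainty_prime_sharp[OF assms])
  thus ?thesis
    using that[of "g \<otimes>\<^sub>f translate 0 delta"]
    by (simp add: card_supp_tensor_delta card_supp_plane_fourier_tensor_delta)
qed

lemma theta_small:
  assumes k: "1 \<le> k" "k \<le> CARD('p::prime_card)"
  shows "theta k TYPE('p plane) = enat (CARD('p) * (CARD('p) + 1 - k))"
proof (rule antisym)
  obtain f :: "'p plane \<Rightarrow> complex" where
    f: "card (supp f) = k" "card (supp (plane_fourier f)) = CARD('p) * (CARD('p) + 1 - k)"
    by (rule small_supp_sharp[OF k])
  have "f \<noteq> (\<lambda>_. 0)" using f(1) k by (auto simp: supp_eq)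
  from theta_le[OF this, of k] f show "theta k TYPE('p plane) \<le> enat (CARD('p) * (CARD('p) + 1 - k))"
    by simp
  show "enat (CARD('p) * (CARD('p) + 1 - k)) \<le> theta k TYPE('p plane)"
  proof (rule theta_ge)
    fix f :: "'p plane \<Rightarrow> complex" assume f: "f \<noteq> (\<lambda>_. 0)" "card (supp f) \<le> k"
    have "CARD('p) * (CARD('p) + 1 - k) \<le> CARD('p) * (CARD('p) + 1 - card (supp f))"
      using f by (intro mult_le_mono2) simp
    also have "\<dots> \<le> card (supp (plane_fourier f))" using f k by (intro small_supp_bound) auto
    finally show "CARD('p) * (CARD('p) + 1 - k) \<le> card (supp (plane_fourier f))" .
  qed
qed

text \<open>Inversion turns this into \<open>small_supp_bound\<close> for the transform: at most
  \<open>p - j\<close> points there would force at least \<open>p * (j + 1)\<close> points in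
  \<open>supp f\<close>.\<close>

lemma large_supp_bound:
  fixes f :: "'p::prime_card plane \<Rightarrow> complex"
  assumes f: "f \<noteq> (\<lambda>_. 0)" "card (supp f) < CARD('p) * (j + 1)"
  shows "CARD('p) + 1 - j \<le> card (supp (plane_fourier f))"
proof (rule ccontr)
  let ?l = "card (supp (plane_fourier f))"
  assume "\<not> CARD('p) + 1 - j \<le> ?l"
  hence l: "?l + j < CARD('p) + 1" by simp
  have "CARD('p) * (j + 1) \<le> CARD('p) * (CARD('p) + 1 - ?l)"
    using l by (intro mult_le_mono2) simp
  also have "\<dots> \<le> card (supp (plane_fourier (plane_fourier f)))"
    using f l by (intro small_supp_bound) (simp_all add: plane_fourier_eq_0_iff)
  finally show False using f by (simp add: card_supp_plane_fourier_twice)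
qed

text \<open>The minimum is attained by the transform of an extremal function with
  \<open>p + 1 - j\<close> points, whose support has exactly \<open>p * j\<close> points.\<close>

lemma theta_large:
  assumes j: "1 \<le> j" "j \<le> CARD('p::prime_card)"
    and k: "CARD('p) * j \<le> k" "k < CARD('p) * (j + 1)"
  shows "theta k TYPE('p plane) = enat (CARD('p) + 1 - j)"
proof (rule antisym)
  obtain h :: "'p plane \<Rightarrow> complex" where
    h: "card (supp h) = CARD('p) + 1 - j"
      "card (supp (plane_fourier h)) = CARD('p) * (CARD('p) + 1 - (CARD('p) + 1 - j))"
    by (rule small_supp_sharp[where 'p='p and k="CARD('p) + 1 - j"]) (use j in auto)
  have "h \<noteq> (\<lambda>_. 0)" using h(1) j by (auto simp: supp_eq)
  hence "plane_fourier h \<noteq> (\<lambda>_. 0)" by (simp add: plane_fourier_eq_0_iff)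
  from theta_le[OF this, of k] show "theta k TYPE('p plane) \<le> enat (CARD('p) + 1 - j)"
    using h j k by (simp add: card_supp_plane_fourier_twice)
  show "enat (CARD('p) + 1 - j) \<le> theta k TYPE('p plane)"
    using k by (intro theta_ge large_supp_bound) auto
qed

section \<open>Existence of equality cases and strict decrease of \<open>theta\<close>\<close>

lemma equality_case_small:
  fixes f :: "'p::prime_card plane \<Rightarrow> complex"
  assumes "1 \<le> k" "k \<le> CARD('p)"
  shows "equality_case k f \<longleftrightarrow>
    card (supp f) = k \<and> card (supp (plane_fourier f)) = CARD('p) * (CARD('p) + 1 - k)"
  by (simp add: equality_case_plane theta_small[OF assms])

text \<open>A noncollinear support costs at least \<open>p\<close> more points in the transform than
  the minimum.\<close>

lemma equality_case_small_collinear: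
  fixes f :: "'p::prime_card plane \<Rightarrow> complex"
  assumes k: "1 \<le> k" "k \<le> CARD('p)" and f: "equality_case k f"
  shows "collinear_supp f"
proof (rule ccontr)
  assume nc: "\<not> collinear_supp f"
  have f': "card (supp f) = k" "card (supp (plane_fourier f)) = CARD('p) * (CARD('p) + 1 - k)"
    using f by (simp_all add: equality_case_small[OF k])
  have "CARD('p) * (CARD('p) + 2 - k) \<le> CARD('p) * (CARD('p) + 1 - k)"
    using noncollinear_bound[OF nc] f' k by simp
  hence "CARD('p) + 2 - k \<le> CARD('p) + 1 - k" by (simp only: mult_le_cancel1) simp
  thus False using k by linarith
qed

lemma mult_between_imp_eq:
  fixes i j p :: nat
  assumes "p * j \<le> p * i" "p * i < p * (j + 1)"
  shows "i = j"
proof -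
  have "i < j + 1" using assms(2) by (simp only: mult_less_cancel1)
  moreover have "j \<le> i" using assms by (simp only: mult_le_cancel1) auto
  ultimately show ?thesis by simp
qed

text \<open>The transform of an equality case has \<open>p + 1 - j\<close> points. If they are
  collinear, \<open>k\<close> is a multiple of \<open>p\<close>; if not, \<open>k\<close> is too
  large.\<close>

lemma exists_equality_case_large_iff:
  assumes j: "1 \<le> j" "j \<le> CARD('p::prime_card)"
    and k: "CARD('p) * j \<le> k" "k < CARD('p) * (j + 1)" "k \<le> CARD('p)\<^sup>2"
  shows "(\<exists>f :: 'p plane \<Rightarrow> complex. equality_case k f) \<longleftrightarrow> k = CARD('p) * j"
proof
  assume "\<exists>f :: 'p plane \<Rightarrow> complex. equality_case k f"
  then obtain f :: "'p plane \<Rightarrow> complex" where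
    f: "card (supp f) = k" "card (supp (plane_fourier f)) = CARD('p) + 1 - j"
    by (auto simp: equality_case_plane theta_large[OF j k(1,2)])
  let ?g = "plane_fourier f"
  have g: "card (supp (plane_fourier ?g)) = k" by (simp add: card_supp_plane_fourier_twice f)
  have gl: "card (supp ?g) \<le> CARD('p)" using f j by simp
  have "?g \<noteq> (\<lambda>_. 0)" using f(2) j by (auto simp: supp_eq)
  show "k = CARD('p) * j"
  proof (cases "collinear_supp ?g")
    case True
    from collinear_bound(2)[OF True \<open>?g \<noteq> (\<lambda>_. 0)\<close>] obtain i where i: "k = CARD('p) * i"
      unfolding g by (elim dvdE)
    thus ?thesis using k(1,2) mult_between_imp_eq by blast
  next
    case False
    \<comment> \<open>With \<open>p + 1 - j\<close> points the bound is \<open>p * (j + 1)\<close>,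
      beyond the range of \<open>k\<close>.\<close>
    from noncollinear_bound[OF False gl] have "CARD('p) * (CARD('p) + 2 - (CARD('p) + 1 - j)) \<le> k"
      unfolding g f(2) .
    hence "CARD('p) * (j + 1) \<le> k" using j by (simp add: algebra_simps)
    with k(2) show ?thesis by simp
  qed
next
  assume kj: "k = CARD('p) * j"
  obtain h :: "'p plane \<Rightarrow> complex" where
    h: "card (supp h) = CARD('p) + 1 - j"
      "card (supp (plane_fourier h)) = CARD('p) * (CARD('p) + 1 - (CARD('p) + 1 - j))"
    by (rule small_supp_sharp[where 'p='p and k="CARD('p) + 1 - j"]) (use j in auto)
  have "equality_case k (plane_fourier h)"
    unfolding equality_case_plane theta_large[OF j k(1,2)] card_supp_plane_fourier_twice
    using h j kj by simp
  thus "\<exists>f :: 'p plane \<Rightarrow> complex. equality_case k f" by blast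
qed

lemma quotient_bounds:
  fixes p k :: nat
  assumes "p \<le> k" "k \<le> p\<^sup>2" "0 < p"
  obtains j where "1 \<le> j" "j \<le> p" "p * j \<le> k" "k < p * (j + 1)"
proof (rule that[of "k div p"])
  show "1 \<le> k div p" using assms by (simp add: Suc_le_eq div_greater_zero_iff)
  show "k div p \<le> p" using div_le_mono[OF assms(2), of p] assms(3) by (simp add: power2_eq_square)
  show "p * (k div p) \<le> k" by simp
  show "k < p * (k div p + 1)" using assms(3) dividend_less_times_div[of p k] by simp
qed

lemma exists_equality_case_iff:
  assumes "1 \<le> k" "k \<le> CARD('p::prime_card)\<^sup>2"
  shows "(\<exists>f :: 'p plane \<Rightarrow> complex. equality_case k f) \<longleftrightarrow> k \<le> CARD('p) \<or> CARD('p) dvd k"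
proof (cases "k \<le> CARD('p)")
  case True
  obtain f :: "'p plane \<Rightarrow> complex" where
    "card (supp f) = k" "card (supp (plane_fourier f)) = CARD('p) * (CARD('p) + 1 - k)"
    by (rule small_supp_sharp[OF assms(1) True])
  thus ?thesis using True by (auto simp: equality_case_small[OF assms(1) True])
next
  case False
  obtain j where j: "1 \<le> j" "j \<le> CARD('p)" "CARD('p) * j \<le> k" "k < CARD('p) * (j + 1)"
    by (rule quotient_bounds[of "CARD('p)" k]) (use False assms in auto)
  have "i = j" if "k = CARD('p) * i" for i
    using mult_between_imp_eq j(3,4) that by blast
  hence "k = CARD('p) * j \<longleftrightarrow> CARD('p) dvd k" by (auto elim!: dvdE)
  thus ?thesis using False exists_equality_case_large_iff[OF j assms(2)] by simp
qed

text \<open>\<open>theta\<close> drops at every step up to \<open>p\<close> and afterwards only at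
  multiples of \<open>p\<close>. The right-hand side is the same criterion as in
  \<open>exists_equality_case_iff\<close>.\<close>

lemma theta_less_iff:
  assumes k: "1 \<le> k" "k \<le> CARD('p::prime_card)\<^sup>2"
  shows "theta k TYPE('p plane) < theta (k - 1) TYPE('p plane) \<longleftrightarrow> k \<le> CARD('p) \<or> CARD('p) dvd k"
proof (cases "k \<le> CARD('p)")
  case True
  show ?thesis
  proof (cases "k = 1")
    case True
    \<comment> \<open>Only the zero function has empty support, so \<open>theta\<close> at 0 is an
      infimum over the empty set.\<close>
    have "{enat (card (fourier_supp f)) |f :: 'p plane \<Rightarrow> complex. f \<noteq> (\<lambda>_. 0) \<and> card (supp f) \<le> 0} = {}"
      using card_supp_eq_0_iff by auto
    hence "theta 0 TYPE('p plane) = \<infinity>" unfolding theta_def by (simp only: Inf_empty top_enat_def)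
    thus ?thesis using \<open>k \<le> CARD('p)\<close> True theta_small[OF k(1) \<open>k \<le> CARD('p)\<close>] by simp
  next
    case False
    hence "CARD('p) + 1 - k < CARD('p) + 1 - (k - 1)" using k True by linarith
    thus ?thesis using theta_small[OF k(1) True] theta_small[of "k - 1", where 'p='p] False k True by simp
  qed
next
  case False
  obtain j where j: "1 \<le> j" "j \<le> CARD('p)" "CARD('p) * j \<le> k" "k < CARD('p) * (j + 1)"
    by (rule quotient_bounds[of "CARD('p)" k]) (use False k in auto)
  show ?thesis
  proof (cases "CARD('p) dvd k")
    case True
    then obtain i where i: "k = CARD('p) * i" by (elim dvdE)
    hence kj: "k = CARD('p) * j" using mult_between_imp_eq j(3,4) by blast
    \<comment> \<open>This keeps \<open>j - 1\<close> in the range of \<open>theta_large\<close>,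
      which is then applied to \<open>k - 1\<close>.\<close>
    hence "j \<ge> 2" using False j(1) by (cases "j = 1") auto
    have "theta (k - 1) TYPE('p plane) = enat (CARD('p) + 1 - (j - 1))"
    proof (rule theta_large)
      have "CARD('p) * (j - 1) + CARD('p) = k" using kj j(1) by (simp add: algebra_simps flip: mult_Suc_right)
      moreover have "CARD('p) > 0" by simp
      ultimately show "CARD('p) * (j - 1) \<le> k - 1" by linarith
      show "k - 1 < CARD('p) * (j - 1 + 1)" using kj j k by simp
    qed (use \<open>j \<ge> 2\<close> j in auto)
    moreover have "CARD('p) + 1 - j < CARD('p) + 1 - (j - 1)" using \<open>j \<ge> 2\<close> j by linarith
    ultimately show ?thesis using True theta_large[OF j] by simp
  next
    case ndvd: False
    hence "CARD('p) * j \<noteq> k" by auto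
    hence "CARD('p) * j \<le> k - 1" "k - 1 < CARD('p) * (j + 1)" using j by linarith+
    from theta_large[OF j(1,2) this] theta_large[OF j] show ?thesis using False ndvd by simp
  qed
qed

section \<open>Shape of the equality cases on lines and behaviour under the transform\<close>

lemma collinear_supp_translate:
  fixes f :: "'p::prime_card plane \<Rightarrow> complex"
  assumes "equality_case k f" "collinear_supp f"
  shows "\<exists>c h m. equality_case k h \<and> m \<noteq> 0 \<and> supp h \<subseteq> line m \<and> f = translate c h"
proof -
  obtain c m where cm: "m \<noteq> 0" "\<And>x. f x \<noteq> 0 \<Longrightarrow> x - c \<in> line m"
    using assms(2) by (auto simp: collinear_supp_def supp_eq)
  have "equality_case k (translate (- c) f)"
    using assms(1) by (simp add: equality_case_plane card_supp_translate card_supp_plane_fourier_translate)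
  moreover have "supp (translate (- c) f) \<subseteq> line m"
  proof
    fix x assume "x \<in> supp (translate (- c) f)"
    hence "f (x + c) \<noteq> 0" by (simp add: supp_eq translate_def)
    from cm(2)[OF this] show "x \<in> line m" by simp
  qed
  moreover have "f = translate c (translate (- c) f)" by (simp add: translate_def)
  ultimately show ?thesis using cm(1) by blast
qed

text \<open>\<open>A m\<close> is the change to the basis formed by \<open>m\<close> and
  \<open>m\<close> turned by a right angle, with determinant
  \<open>(m $ 1)\<^sup>2 + (m $ 2)\<^sup>2\<close>.\<close>

lemma A_mult_eq_lin: "A m *v x = lin m (vector [- (m $ 2), m $ 1]) x"
  by (simp add: A_def lin_def plane_eq_iff matrix_vector_mult_def sum_2 mult.commute)

text \<open>Trades the inverse matrix for substitution of \<open>lin\<close>, so that the coordinate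
  lemmas apply.\<close>

lemma transform_A_lin:
  fixes m :: "'p::prime_card plane"
  assumes "(m $ 1)\<^sup>2 + (m $ 2)\<^sup>2 \<noteq> 0"
  shows "F = transform (A m) G \<longleftrightarrow> (\<forall>x. F (lin m (vector [- (m $ 2), m $ 1]) x) = G x)"
proof -
  have "Determinants.det (A m) \<noteq> 0" using assms by (simp add: A_def det_2 power2_eq_square)
  hence "\<exists>B. A m ** B = Finite_Cartesian_Product.mat 1 \<and> B ** A m = Finite_Cartesian_Product.mat 1"
    using invertible_det_nz[of "A m"] by (simp add: invertible_def)
  hence "A m ** matrix_inv (A m) = Finite_Cartesian_Product.mat 1 \<and>
      matrix_inv (A m) ** A m = Finite_Cartesian_Product.mat 1"
    \<comment> \<open>\<open>matrix_inv\<close> is a choice, so its two defining equations come from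
      the existence of an inverse.\<close>
    unfolding matrix_inv_def by (rule someI_ex)
  hence "A m *v (matrix_inv (A m) *v x) = x" "matrix_inv (A m) *v (A m *v x) = x" for x
    by (simp_all add: matrix_vector_mul_assoc)
  thus ?thesis by (auto simp: transform_def A_mult_eq_lin fun_eq_iff) metis
qed

text \<open>In the basis of \<open>A m\<close>, functions supported in a coset of
  \<open>line m\<close> live on one horizontal line, hence are tensors with a shifted
  \<open>delta\<close>; the shift \<open>a\<close> is the second coordinate of the
  translation.\<close>

lemma equality_cases_on_line:
  fixes m :: "'p::prime_card plane"
  assumes k: "1 \<le> k" "k \<le> CARD('p)" and m: "(m $ 1)\<^sup>2 + (m $ 2)\<^sup>2 \<noteq> 0"
  shows "{translate c h | c h. equality_case k h \<and> supp h \<subseteq> line m} =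
    {transform (A m) (f \<otimes>\<^sub>f translate a delta) | f a.
      card (supp f) = k \<and> card (fourier_supp f) = CARD('p) - k + 1}"
proof -
  define n :: "'p plane" where "n = vector [- (m $ 2), m $ 1]"
  have det: "m $ 1 * n $ 2 - m $ 2 * n $ 1 \<noteq> 0" using m by (simp add: n_def power2_eq_square)
  note transf = transform_A_lin[OF m, folded n_def]
  note bij = bij_lin[OF det]
  \<comment> \<open>The factor \<open>p\<close> contributed by \<open>delta\<close> cancels against
    the one in \<open>equality_case_small\<close>.\<close>
  have equality_iff: "equality_case k F \<longleftrightarrow> card (supp f) = k \<and> card (fourier_supp f) = CARD('p) - k + 1"
    if "\<And>x. F (lin m n x) = (f \<otimes>\<^sub>f translate a delta) x" for F f and a :: "'p mod_ring"
  proof -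
    have F: "(\<lambda>x. F (lin m n x)) = f \<otimes>\<^sub>f translate a delta" using that by auto
    have "card (supp F) = card (supp f)"
      using card_supp_comp_bij[OF bij, of F] unfolding F card_supp_tensor_delta by simp
    moreover have "card (supp (plane_fourier F)) = CARD('p) * card (fourier_supp f)"
      using card_supp_plane_fourier_lin[OF det, of F]
      unfolding F card_supp_plane_fourier_tensor_delta card_fourier_supp_mod_ring by simp
    moreover have "CARD('p) - k + 1 = CARD('p) + 1 - k" using k by simp
    ultimately show ?thesis by (simp add: equality_case_small[OF k])
  qed
  show ?thesis
  proof (intro subset_antisym subsetI)
    fix F assume "F \<in> {translate c h | c h. equality_case k h \<and> supp h \<subseteq> line m}"
    then obtain c h where F: "F = translate c h" and h: "equality_case k h" "supp h \<subseteq> line m" by blast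
    obtain d where d: "c = lin m n d" using bij by (metis bij_pointE)
    define G where "G x = F (lin m n x)" for x
    define f where "f s = G (vector [s, d $ 2])" for s
    have "x $ 2 = d $ 2" if "G x \<noteq> 0" for x
    proof -
      have "h (lin m n (x - d)) \<noteq> 0" using that by (simp add: G_def F translate_def d lin_simps)
      hence "lin m n (x - d) \<in> line m" using h(2) by (auto simp: supp_eq)
      thus ?thesis by (simp add: line_iff[OF det])
    qed
    hence G: "G = f \<otimes>\<^sub>f translate (d $ 2) delta" unfolding f_def by (rule tensor_delta_of_section)
    have "equality_case k F"
      using h(1) by (simp add: F equality_case_plane card_supp_translate card_supp_plane_fourier_translate)
    hence "card (supp f) = k \<and> card (fourier_supp f) = CARD('p) - k + 1"
      using equality_iff[of F f "d $ 2"] by (simp add: G_def flip: G)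
    moreover have "F = transform (A m) (f \<otimes>\<^sub>f translate (d $ 2) delta)"
      unfolding transf G[symmetric] by (simp add: G_def)
    ultimately show "F \<in> {transform (A m) (f \<otimes>\<^sub>f translate a delta) | f a.
      card (supp f) = k \<and> card (fourier_supp f) = CARD('p) - k + 1}" by blast
  next
    fix F assume "F \<in> {transform (A m) (f \<otimes>\<^sub>f translate a delta) | f a.
      card (supp f) = k \<and> card (fourier_supp f) = CARD('p) - k + 1}"
    then obtain f a where F: "F = transform (A m) (f \<otimes>\<^sub>f translate a delta)"
      and f: "card (supp f) = k \<and> card (fourier_supp f) = CARD('p) - k + 1" by blast
    have Fl: "F (lin m n x) = (f \<otimes>\<^sub>f translate a delta) x" for x using F transf by blast
    \<comment> \<open>The translation that moves row \<open>a\<close> to row 0, which is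
      \<open>line m\<close> in these coordinates.\<close>
    define c where "c = lin m n (vector [0, a])"
    have "equality_case k F" using equality_iff[OF Fl] f by simp
    hence "equality_case k (translate (- c) F)"
      by (simp add: equality_case_plane card_supp_translate card_supp_plane_fourier_translate)
    moreover have "supp (translate (- c) F) \<subseteq> line m"
    proof
      fix y assume y: "y \<in> supp (translate (- c) F)"
      obtain x where x: "y = lin m n x" using bij by (metis bij_pointE)
      have "F (lin m n (x + vector [0, a])) \<noteq> 0"
        using y by (simp add: supp_eq translate_def c_def x lin_simps)
      hence "x $ 2 = 0"
        by (auto simp: Fl tensor_def translate_def delta_def indicator_def split: if_splits)
      thus "y \<in> line m" by (simp add: x line_iff[OF det])
    qed
    moreover have "F = translate c (translate (- c) F)" by (simp add: translate_def)
    ultimately show "F \<in> {translate c h | c h. equality_case k h \<and> supp h \<subseteq> line m}" by blast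
  qed
qed

text \<open>Both conditions ask for the same pair of support sizes, \<open>p * j\<close> for
  \<open>f\<close> and \<open>p - j + 1\<close> for its transform; surjectivity of the transform
  gives the whole set.\<close>

lemma plane_fourier_image_equality_cases:
  assumes j: "1 \<le> j" "j \<le> CARD('p::prime_card)"
  shows "plane_fourier ` {f :: 'p plane \<Rightarrow> complex. equality_case (CARD('p) * j) f} =
    {g. equality_case (CARD('p) - j + 1) g}"
proof -
  have k: "CARD('p) * j \<le> CARD('p) * j" "CARD('p) * j < CARD('p) * (j + 1)" by simp_all
  have l: "1 \<le> CARD('p) - j + 1" "CARD('p) - j + 1 \<le> CARD('p)" using j by simp_all
  have "CARD('p) + 1 - (CARD('p) - j + 1) = j" "CARD('p) + 1 - j = CARD('p) - j + 1" using j by simp_all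
  hence iff: "equality_case (CARD('p) * j) f \<longleftrightarrow> equality_case (CARD('p) - j + 1) (plane_fourier f)"
    for f :: "'p plane \<Rightarrow> complex"
    unfolding equality_case_small[OF l] equality_case_plane[of "CARD('p) * j"] theta_large[OF j k]
      card_supp_plane_fourier_twice by auto
  show ?thesis
  proof (intro subset_antisym subsetI)
    fix g :: "'p plane \<Rightarrow> complex" assume g: "g \<in> {g. equality_case (CARD('p) - j + 1) g}"
    obtain f where "plane_fourier f = g" using surj_plane_fourier by blast
    thus "g \<in> plane_fourier ` {f. equality_case (CARD('p) * j) f}" using g iff by blast
  qed (use iff in auto)
qed

theorem theorem23:
  fixes p k :: nat
  assumes p: "p = CARD('p::prime_card)"
    and k: "1 \<le> k" "k \<le> p\<^sup>2"
  shows "((\<exists>f :: 'p plane \<Rightarrow> complex. equality_case k f) \<longleftrightarrow>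
           theta k TYPE('p plane) < theta (k - 1) TYPE('p plane))
    \<and> (k \<le> p \<longrightarrow>
        (\<forall>f :: 'p plane \<Rightarrow> complex. equality_case k f \<longrightarrow>
           (\<exists>c h m. equality_case k h \<and> m \<noteq> 0 \<and> supp h \<subseteq> line m \<and> f = translate c h))
      \<and> (\<forall>m :: 'p plane. (m $ 1)\<^sup>2 + (m $ 2)\<^sup>2 \<noteq> 0 \<longrightarrow>
           {translate c h | c h. equality_case k h \<and> supp h \<subseteq> line m} =
           {transform (A m) (f \<otimes>\<^sub>f translate a delta) | f a.
              card (supp f) = k \<and> card (fourier_supp f) = p - k + 1}))
    \<and> (p \<le> k \<and> k \<le> p\<^sup>2 - 1 \<longrightarrow>
        ((\<exists>f :: 'p plane \<Rightarrow> complex. equality_case k f) \<longleftrightarrow> p dvd k)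
      \<and> (\<forall>j. k = p * j \<longrightarrow>
           plane_fourier ` {f :: 'p plane \<Rightarrow> complex. equality_case k f} =
           {g. equality_case (p - j + 1) g}))"
proof (intro conjI impI allI)
  have k': "k \<le> CARD('p)\<^sup>2" using k p by simp
  note exists = exists_equality_case_iff[OF k(1) k', folded p]
  show "(\<exists>f :: 'p plane \<Rightarrow> complex. equality_case k f) \<longleftrightarrow>
      theta k TYPE('p plane) < theta (k - 1) TYPE('p plane)"
    unfolding exists theta_less_iff[OF k(1) k', folded p] ..
  show "\<exists>c h m. equality_case k h \<and> m \<noteq> 0 \<and> supp h \<subseteq> line m \<and> f = translate c h"
    if "k \<le> p" "equality_case k f" for f :: "'p plane \<Rightarrow> complex"
    using that k p by (intro collinear_supp_translate equality_case_small_collinear) auto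
  show "{translate c h | c h. equality_case k h \<and> supp h \<subseteq> line m} =
      {transform (A m) (f \<otimes>\<^sub>f translate a delta) | f a.
        card (supp f) = k \<and> card (fourier_supp f) = p - k + 1}"
    if "k \<le> p" "(m $ 1)\<^sup>2 + (m $ 2)\<^sup>2 \<noteq> 0" for m :: "'p plane"
    unfolding p by (rule equality_cases_on_line) (use that k p in auto)
  \<comment> \<open>Given \<open>p \<le> k\<close>, the alternative \<open>k \<le> p\<close> leaves
    only \<open>k = p\<close>, a multiple of \<open>p\<close>.\<close>
  show "(\<exists>f :: 'p plane \<Rightarrow> complex. equality_case k f) \<longleftrightarrow> p dvd k" if "p \<le> k \<and> k \<le> p\<^sup>2 - 1"
    unfolding exists using that by (metis dvd_refl le_antisym)
  show "plane_fourier ` {f :: 'p plane \<Rightarrow> complex. equality_case k f} = {g. equality_case (p - j + 1) g}"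
    if "p \<le> k \<and> k \<le> p\<^sup>2 - 1" "k = p * j" for j
    unfolding p that(2)
  proof (rule plane_fourier_image_equality_cases)
    show "1 \<le> j" using that k by (cases j) auto
    show "j \<le> CARD('p)" using that k p by (simp add: power2_eq_square)
  qed
qed

end
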